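(* Let $\mathbb{K}$ be an algebraically closed field of characteristic zero, let $S^\bullet=\operatorname{Sym}^\bullet S^1$ and $S_\bullet=\operatorname{Sym}^\bullet S_1$ be symmetric $\mathbb{K}$-algebras with an apolarity pairing, and suppose that $\dim S_1=3$. Let $f\in S_4$ and let $x^0,x^1,x^2\in S^1$ be linearly independent forms such that $\partial_{x^0x^1x^2}f=0$. Let $\sigma$ be the cyclic permutation $0\mapsto1,\ 1\mapsto2,\ 2\mapsto0$, and for each $i\in\{0,1,2\}$ put $i':=\sigma(i)$, $i'':=\sigma(i')$, $$q_i:=\partial_{x^{i'}x^{i''}}f,\qquad \langle v_i\rangle:=\langle x^{i'},x^{i''}\rangle^\perp\subset S_1 .$$ For each $i$ consider the dually paired rings $S_{i,\bullet}:=\ker\partial_{x^i}\subset S_\bullet$ and $S_i^\bullet:=S^\bullet/(x^i)$. Suppose that: (1) none of $q_0,q_1,q_2$ is a square (of a linear form); then, for each $i$, let $$\theta_i:\mathbb{P}\langle q_i\rangle^\perp\to\mathbb{P}\langle q_{i'}\rangle^\perp$$ (where $\langle q_i\rangle^\perp\subset S_i^2$ and $\langle q_{i'}\rangle^\perp\subset S_{i'}^2$) be the isomorphism $\theta_{c;a,b}$ defined in the context, with $c=\partial_{x^{i''}}f$, $a=x^i$, $b=x^{i'}$; (2) $\langle h^0\rangle\in\mathbb{P}\langle q_0\rangle^\perp$ is a fixed point of $\theta_2\circ\theta_1\circ\theta_0$; (3) setting $\langle h^1\rangle:=\theta_0(\langle h^0\rangle)$ and $\langle h^2\rangle:=\theta_1(\langle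 h^1\rangle)$, the roots of $\langle h^0\rangle$, $\langle h^1\rangle$, $\langle h^2\rangle$ in the lines $\mathbb{P}S_{0,1}$, $\mathbb{P}S_{1,1}$, $\mathbb{P}S_{2,1}$, respectively (two roots for each, six in all), are distinct and different from $\langle v_0\rangle$, $\langle v_1\rangle$, $\langle v_2\rangle$. Then $f$ admits a decomposition as a sum of exactly six fourth powers of linear forms, whose spans are the six roots mentioned in (3): that is, if $R_1,\dots,R_6\in\mathbb{P}S_1$ are these six roots, there are nonzero $\ell_1,\dots,\ell_6\in S_1$ with $\langle\ell_j\rangle=R_j$ for all $j$ and $f=\ell_1^4+\cdots+\ell_6^4$.
   Context: Notation. $\mathbb{K}$ is an algebraically closed field of characteristic zero. $S^\bullet=\operatorname{Sym}^\bullet S^1$ and $S_\bullet=\operatorname{Sym}^\bullet S_1$ are symmetric algebras, with $S^1$ and $S_1$ finite-dimensional and dual to each other, with degree $d$ components $S^d$ and $S_d$. They can be regarded as polynomial rings in the same number of indeterminates, with $S^\bullet$ acting on $S_\bullet$ by constant coefficients partial differentiation (apolarity); $\partial_x f$ denotes the action of $x\in S^\bullet$ on $f\in S_\bullet$. The evaluation of $x\in S^d$ at $v\in S_1$ is $x(v):=\partial_x v^d/d!$. Span is denoted by $\langle\ \rangle$; $\mathbb{P}V$ is the set of one-dimensional subspaces $\langle v\rangle$ of $V$, $v\ne0$; $\perp$ denotes orthogonality with respect to the apolarity pairing $S^d\times S_d\to\mathbb{K}$ in the relevant degree $d$. For nonzero $a\in S^1$, put $S_{a,\bullet}:=\ker\partial_a\subset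 S_\bullet$ and $S_a^\bullet:=S^\bullet/(a)$, with the induced apolarity pairing; when $\dim S_1=3$ these are algebras in two indeterminates. For $a=x^i$ they are written $S_{i,\bullet}$ and $S_i^\bullet$, with degree $d$ components $S_{i,d}$ and $S_i^d$. For a nonzero $q\in S_{a,2}$, $\langle q\rangle^\perp$ is understood inside $S_a^2$. The roots of $\langle h\rangle\in\mathbb{P}S_i^2$ in the line $\mathbb{P}S_{i,1}$ are the points $\langle u\rangle\in\mathbb{P}S_{i,1}$ such that $h(u)=0$ (two, counted with multiplicity). Definition of $\theta_{c;a,b}$. Let $\dim S_1=3$, let $a,b\in S^1$ be linearly independent and let $c\in S_3$ be such that $\partial_{ab}c=0$, and $q_a:=\partial_b c$ and $q_b:=\partial_a c$ are nonzero and not squares. Thus $q_a\in S_{a,2}$ and $q_b\in S_{b,2}$. Set $$L_a:=S_{a,3}\cap\partial_b^{-1}(\langle q_a\rangle),\qquad L_b:=S_{b,3}\cap\partial_a^{-1}(\langle q_b\rangle).$$ These are two-dimensional vector spaces. (i) For $F\in L_a$, let $\lambda(F)\in\mathbb{K}$ be the scalar with $\partial_b F=\lambda(F)q_a$. The map $\psi:L_a\to L_b$, $F\mapsto\lambda(F)c-F$, is a vector space isomorphism, and it induces $\mathbb{P}\psi:\mathbb{P}L_a\to\mathbb{P}L_b$. (ii) Since $q_a$ is not a square, there is an isomorphism of projective lines $\omega_a:\mathbb{P}\langle q_a\rangle^\perp\to\mathbb{P}L_a$ characterized by: for $\langle h\rangle\in\mathbb{P}\langle q_a\rangle^\perp$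 and $\langle F\rangle\in\mathbb{P}L_a$, one has $\langle F\rangle=\omega_a(\langle h\rangle)$ if and only if $\partial_hF=0$. Likewise there is $\omega_b:\mathbb{P}\langle q_b\rangle^\perp\to\mathbb{P}L_b$ with the analogous characterization. Then $\theta_{c;a,b}:=\omega_b^{-1}\circ\mathbb{P}\psi\circ\omega_a:\mathbb{P}\langle q_a\rangle^\perp\to\mathbb{P}\langle q_b\rangle^\perp$. With $c=\partial_{x^{i''}}f$, $a=x^i$, $b=x^{i'}$ one has $q_a=\partial_{x^{i'}x^{i''}}f=q_i$, $q_b=\partial_{x^ix^{i''}}f=q_{i'}$ and $\partial_{ab}c=\partial_{x^0x^1x^2}f=0$. *)

theory Defs
  imports
    "HOL-Library.Poly_Mapping"
    "HOL-Library.Numeral_Type"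
    "HOL-Computational_Algebra.Polynomial"
begin

text \<open>
  After choosing dual bases of \<open>S\<^sup>1\<close> and \<open>S\<^sub>1\<close>, indexed by a finite type \<open>'n\<close> with
  \<open>dim S\<^sub>1 = CARD('n)\<close>, both symmetric algebras are the polynomial ring over \<open>'k\<close> in
  indeterminates indexed by \<open>'n\<close>. One type serves for both; the first argument of
  \<open>apolar\<close> is the operator.

  In \<open>proposition3p3\<close> the indices of \<open>x\<^sup>i, q\<^sub>i, v\<^sub>i, \<theta>\<^sub>i\<close> range over the type
  \<open>3\<close>, the integers modulo 3, so \<open>i' = i + 1\<close> and \<open>i'' = i + 2\<close>. The point \<open>H i\<close> is
  \<open>\<langle>h\<^sup>i\<rangle>\<close>, and the two roots of \<open>h\<^sup>i\<close> are distinct iff \<open>qroots\<close> has two elements.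
\<close>

type_synonym ('n, 'k) sym = "('n \<Rightarrow>\<^sub>0 nat) \<Rightarrow>\<^sub>0 'k"

definition scale :: "'k::field \<Rightarrow> ('n, 'k) sym \<Rightarrow> ('n, 'k) sym" where
  "scale c p = Poly_Mapping.single 0 c * p"

global_interpretation sym: vector_space "scale :: 'k::field \<Rightarrow> ('n, 'k) sym \<Rightarrow> ('n, 'k) sym"
  by unfold_locales
    (simp_all add: scale_def algebra_simps single_add mult_single flip: mult.assoc)

text \<open>The component of degree \<open>d\<close> (\<open>S\<^sup>d\<close> or \<open>S\<^sub>d\<close>).\<close>

definition homog :: "nat \<Rightarrow> ('n::finite, 'k::field) sym set" where
  "homog d = {p. \<forall>m\<in>Poly_Mapping.keys p. (\<Sum>i\<in>UNIV. Poly_Mapping.lookup m i) = d}"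

text \<open>
  \<open>\<partial>\<^sub>x f\<close>: the monomial with exponent \<open>m\<close> acts on the one with exponent \<open>n\<close> as iterated partial
  differentiation, which gives the exponent \<open>n - m\<close> with the product over \<open>i\<close> of the factors
  \<open>n\<^sub>i (n\<^sub>i - 1) \<dots> (n\<^sub>i - m\<^sub>i + 1) = m\<^sub>i! (n\<^sub>i choose m\<^sub>i)\<close>. That factor
  vanishes as soon as \<open>m\<^sub>i > n\<^sub>i\<close>, so truncated subtraction of exponents is harmless.
\<close>

definition apolar :: "('n::finite, 'k::field) sym \<Rightarrow> ('n, 'k) sym \<Rightarrow> ('n, 'k) sym" where
  "apolar x f =
     (\<Sum>m\<in>Poly_Mapping.keys x. \<Sum>n\<in>Poly_Mapping.keys f.
        Poly_Mapping.single (n - m)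
          (Poly_Mapping.lookup x m * Poly_Mapping.lookup f n *
             (\<Prod>i\<in>UNIV. of_nat (fact (Poly_Mapping.lookup m i) *
                (Poly_Mapping.lookup n i choose Poly_Mapping.lookup m i)))))"

text \<open>In equal degrees \<open>\<partial>\<^sub>x f\<close> lies in \<open>S\<^sub>0\<close>; the pairing is its constant coefficient.\<close>

definition pairing :: "('n::finite, 'k::field) sym \<Rightarrow> ('n, 'k) sym \<Rightarrow> 'k" where
  "pairing x f = Poly_Mapping.lookup (apolar x f) 0"

definition perp :: "nat \<Rightarrow> ('n::finite, 'k::field) sym set \<Rightarrow> ('n, 'k) sym set" where
  "perp d X = {f \<in> homog d. \<forall>x\<in>X. pairing x f = 0}"

text \<open>The points of \<open>\<P>V\<close>, as one-dimensional subspaces.\<close>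

definition proj :: "('n, 'k::field) sym set \<Rightarrow> ('n, 'k) sym set set" where
  "proj V = {sym.span {v} | v. v \<in> V \<and> v \<noteq> 0}"

text \<open>\<open>S\<^bsub>a,d\<^esub>\<close>.\<close>

definition kercomp :: "('n::finite, 'k::field) sym \<Rightarrow> nat \<Rightarrow> ('n, 'k) sym set" where
  "kercomp a d = {F \<in> homog d. apolar a F = 0}"

text \<open>
  The quotient \<open>S\<^sub>a\<^sup>\<bullet> = S\<^sup>\<bullet>/(a)\<close>: its elements are the cosets of the ideal \<open>(a)\<close>, and
  \<open>qcomp a d\<close> is the component \<open>S\<^sub>a\<^sup>d\<close>. The operations below are the induced ones,
  computed on representatives; \<open>qapolar X F\<close> is meaningful for \<open>F\<close> in the kernel of \<open>\<partial>\<^sub>a\<close>,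
  where \<open>\<partial>\<^sub>p F\<close> does not depend on \<open>p \<in> X\<close>.
\<close>

definition qclass :: "('n, 'k::field) sym \<Rightarrow> ('n, 'k) sym \<Rightarrow> ('n, 'k) sym set" where
  "qclass a p = {r. a dvd r - p}"

definition qcomp :: "('n::finite, 'k::field) sym \<Rightarrow> nat \<Rightarrow> ('n, 'k) sym set set" where
  "qcomp a d = qclass a ` homog d"

definition qscale :: "('n, 'k::field) sym \<Rightarrow> 'k \<Rightarrow> ('n, 'k) sym set \<Rightarrow> ('n, 'k) sym set" where
  "qscale a c X = (\<Union>p\<in>X. qclass a (scale c p))"

definition qproj :: "('n, 'k::field) sym \<Rightarrow> ('n, 'k) sym set set \<Rightarrow> ('n, 'k) sym set set set" where
  "qproj a V = {range (\<lambda>c. qscale a c X) | X. X \<in> V \<and> X \<noteq> qclass a 0}"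

definition qapolar :: "('n::finite, 'k::field) sym set \<Rightarrow> ('n, 'k) sym \<Rightarrow> ('n, 'k) sym" where
  "qapolar X F = the_elem ((\<lambda>p. apolar p F) ` X)"

definition qpairing :: "('n::finite, 'k::field) sym set \<Rightarrow> ('n, 'k) sym \<Rightarrow> 'k" where
  "qpairing X F = Poly_Mapping.lookup (qapolar X F) 0"

text \<open>\<open>\<langle>q\<rangle>\<^sup>\<bottom> \<subseteq> S\<^sub>a\<^sup>d\<close>.\<close>

definition qperp ::
    "('n::finite, 'k::field) sym \<Rightarrow> nat \<Rightarrow> ('n, 'k) sym \<Rightarrow> ('n, 'k) sym set set" where
  "qperp a d q = {X \<in> qcomp a d. \<forall>F\<in>sym.span {q}. qpairing X F = 0}"

text \<open>The evaluation \<open>X(u) = \<partial>\<^sub>X u\<^sup>d / d!\<close> for \<open>X\<close> of degree \<open>d\<close>.\<close>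

definition qeval ::
    "nat \<Rightarrow> ('n::finite, 'k::field_char_0) sym set \<Rightarrow> ('n, 'k) sym \<Rightarrow> 'k" where
  "qeval d X u = qpairing X (u ^ d) / fact d"

definition qroots ::
    "('n::finite, 'k::field_char_0) sym \<Rightarrow> ('n, 'k) sym set set \<Rightarrow> ('n, 'k) sym set set" where
  "qroots a P = {R \<in> proj (kercomp a 1). \<forall>X\<in>P. \<forall>u\<in>R. qeval 2 X u = 0}"

text \<open>
  \<open>Lspace a b (\<partial>\<^sub>b c)\<close> and \<open>Lspace b a (\<partial>\<^sub>a c)\<close> are \<open>L\<^sub>a\<close> and \<open>L\<^sub>b\<close>; \<open>omega\<close> takes the same
  arguments and, besides, a point of \<open>\<P>\<langle>q\<rangle>\<^sup>\<bottom>\<close>.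
\<close>

definition Lspace ::
    "('n::finite, 'k::field) sym \<Rightarrow> ('n, 'k) sym \<Rightarrow> ('n, 'k) sym \<Rightarrow> ('n, 'k) sym set" where
  "Lspace a b q = {F \<in> kercomp a 3. apolar b F \<in> sym.span {q}}"

definition omega ::
    "('n::finite, 'k::field) sym \<Rightarrow> ('n, 'k) sym \<Rightarrow> ('n, 'k) sym \<Rightarrow>
     ('n, 'k) sym set set \<Rightarrow> ('n, 'k) sym set" where
  "omega a b q P =
     (THE Q. Q \<in> proj (Lspace a b q) \<and> (\<forall>X\<in>P. \<forall>F\<in>Q. qapolar X F = 0))"

definition psi ::
    "('n::finite, 'k::field) sym \<Rightarrow> ('n, 'k) sym \<Rightarrow> ('n, 'k) sym \<Rightarrow> ('n, 'k) sym" where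
  "psi c b F = scale (THE l. apolar b F = scale l (apolar b c)) c - F"

definition theta ::
    "('n::finite, 'k::field) sym \<Rightarrow> ('n, 'k) sym \<Rightarrow> ('n, 'k) sym \<Rightarrow>
     ('n, 'k) sym set set \<Rightarrow> ('n, 'k) sym set set" where
  "theta c a b =
     the_inv_into (qproj b (qperp b 2 (apolar a c))) (omega b a (apolar a c))
     \<circ> image (psi c b)
     \<circ> omega a b (apolar b c)"

end

theory Submission
  imports Defs
begin

text \<open>
  Let \<open>u\<close>, \<open>w\<close> be the two roots of \<open>h\<^sup>i\<close>. As \<open>h\<^sup>i \<perp> q\<^sub>i\<close>, the form \<open>q\<^sub>i\<close> is a combination of
  \<open>u\<^sup>2\<close> and \<open>w\<^sup>2\<close>, with nonzero coefficients because it is not a square. No root is \<open>v\<^sub>j\<close>, so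
  dividing by the values of \<open>x\<^bsup>i'\<^esup>\<close> and \<open>x\<^bsup>i''\<^esup>\<close> at the roots gives a combination \<open>g\<^sub>i\<close> of
  \<open>u\<^sup>4\<close> and \<open>w\<^sup>4\<close> whose derivative along \<open>x\<^bsup>i'\<^esup>x\<^bsup>i''\<^esup>\<close> is \<open>q\<^sub>i\<close>. Up to scalars,
  \<open>\<omega>\<close> sends \<open>\<langle>h\<^sup>i\<rangle>\<close> to the derivative of \<open>g\<^sub>i\<close> along \<open>x\<^bsup>i''\<^esup>\<close>, and \<open>\<omega>\<close> for the index \<open>i'\<close>
  sends \<open>\<langle>h\<^bsup>i'\<^esup>\<rangle>\<close> to the derivative of \<open>g\<^bsub>i'\<^esub>\<close> along the same \<open>x\<^bsup>i''\<^esup>\<close>; the relation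
  \<open>\<langle>h\<^bsup>i'\<^esup>\<rangle> = \<theta>\<^sub>i \<langle>h\<^sup>i\<rangle>\<close> thus says that \<open>f - g\<^sub>i - g\<^bsub>i'\<^esub>\<close> is killed by \<open>x\<^bsup>i''\<^esup>\<close>, and so is
  \<open>g\<^bsub>i''\<^esub>\<close>. Around the cycle, all derivatives of \<open>f - g\<^sub>0 - g\<^sub>1 - g\<^sub>2\<close> vanish.
\<close>

section \<open>Apolarity\<close>

abbreviation const :: "'k::field \<Rightarrow> ('n, 'k) sym" where
  "const \<equiv> Poly_Mapping.single 0"

abbreviation indet :: "'n \<Rightarrow> ('n, 'k::field) sym" where
  "indet i \<equiv> Poly_Mapping.single (Poly_Mapping.single i 1) 1"

definition falling :: "('n::finite \<Rightarrow>\<^sub>0 nat) \<Rightarrow> ('n \<Rightarrow>\<^sub>0 nat) \<Rightarrow> 'k::field" where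
  "falling m n = (\<Prod>i\<in>UNIV. of_nat (fact (Poly_Mapping.lookup m i) *
                (Poly_Mapping.lookup n i choose Poly_Mapping.lookup m i)))"

lemma const_mult: "const (s * t) = (const s * const t :: ('n, 'k::field) sym)"
  by (simp add: mult_single)

lemma const_eq_iff [simp]: "(const s :: ('n, 'k::field) sym) = const t \<longleftrightarrow> s = t"
  by (metis lookup_single_eq)

lemma const_eq_0_iff [simp]: "(const s :: ('n, 'k::field) sym) = 0 \<longleftrightarrow> s = 0"
  by (metis const_eq_iff single_zero)

lemma const_sum: "const (sum s I) = (\<Sum>i\<in>I. const (s i) :: ('n, 'k::field) sym)"
  by (induction I rule: infinite_finite_induct) (simp_all add: single_add)

lemma const_mult_eq_0:
  fixes p :: "('n, 'k::field) sym"
  assumes "s \<noteq> 0" and *: "const s * p = 0"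
  shows "p = 0"
proof -
  have "p = const (inverse s) * (const s * p)"
    using \<open>s \<noteq> 0\<close> by (simp add: mult_single flip: mult.assoc)
  with * show ?thesis by simp
qed

text \<open>The supports in \<open>apolar_def\<close> change under addition. A common finite index
  set for all summands makes additivity a termwise check.\<close>

lemma apolar_superset:
  assumes "finite A" "Poly_Mapping.keys x \<subseteq> A" "finite B" "Poly_Mapping.keys f \<subseteq> B"
  shows "apolar x f = (\<Sum>m\<in>A. \<Sum>n\<in>B. Poly_Mapping.single (n - m)
          (Poly_Mapping.lookup x m * Poly_Mapping.lookup f n * falling m n))"
proof -
  have "apolar x f = (\<Sum>m\<in>Poly_Mapping.keys x. \<Sum>n\<in>B. Poly_Mapping.single (n - m)
          (Poly_Mapping.lookup x m * Poly_Mapping.lookup f n * falling m n))"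
    unfolding apolar_def falling_def
    by (intro sum.cong refl sum.mono_neutral_left) (use assms in \<open>auto simp: in_keys_iff\<close>)
  also have "\<dots> = (\<Sum>m\<in>A. \<Sum>n\<in>B. Poly_Mapping.single (n - m)
          (Poly_Mapping.lookup x m * Poly_Mapping.lookup f n * falling m n))"
    by (intro sum.mono_neutral_left) (use assms in \<open>auto simp: in_keys_iff\<close>)
  finally show ?thesis .
qed

section \<open>Bilinearity of the action and composition of operators\<close>

lemma apolar_add_left: "apolar (x + y) f = apolar x f + apolar y f"
proof -
  let ?A = "Poly_Mapping.keys x \<union> Poly_Mapping.keys y" and ?B = "Poly_Mapping.keys f"
  note e = apolar_superset[of ?A _ ?B f]
  show ?thesis
    using Poly_Mapping.keys_add[of x y]
    by (simp add: e lookup_add single_add distrib_right sum.distrib)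
qed

lemma apolar_add_right: "apolar x (f + g) = apolar x f + apolar x g"
proof -
  let ?A = "Poly_Mapping.keys x" and ?B = "Poly_Mapping.keys f \<union> Poly_Mapping.keys g"
  note e = apolar_superset[of ?A x ?B]
  show ?thesis
    using Poly_Mapping.keys_add[of f g]
    by (simp add: e lookup_add single_add distrib_left distrib_right sum.distrib)
qed

lemma apolar_0_left [simp]: "apolar 0 f = 0"
  and apolar_0_right [simp]: "apolar x 0 = 0"
  by (simp_all add: apolar_def)

lemma apolar_sum_left: "apolar (sum g I) f = (\<Sum>i\<in>I. apolar (g i) f)"
  by (induction I rule: infinite_finite_induct) (auto simp: apolar_add_left)

lemma apolar_sum_right: "apolar x (sum g I) = (\<Sum>i\<in>I. apolar x (g i))"
  by (induction I rule: infinite_finite_induct) (auto simp: apolar_add_right)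

lemma apolar_minus_left: "apolar (- x) f = - apolar x f"
  by (metis add.right_inverse add_eq_0_iff apolar_0_left apolar_add_left)

lemma apolar_minus_right: "apolar x (- f) = - apolar x f"
  by (metis add.right_inverse add_eq_0_iff apolar_0_right apolar_add_right)

lemma apolar_diff_left: "apolar (x - y) f = apolar x f - apolar y f"
  using apolar_add_left[of x "- y" f] by (simp add: apolar_minus_left)

lemma apolar_diff_right: "apolar x (f - g) = apolar x f - apolar x g"
  using apolar_add_right[of x f "- g"] by (simp add: apolar_minus_right)

lemma apolar_single:
  "apolar (Poly_Mapping.single m s) (Poly_Mapping.single n t) =
     Poly_Mapping.single (n - m) (s * t * falling m n)"
  by (subst apolar_superset[of "{m}" _ "{n}"]) auto

lemma sym_eq_sum_single:
  "p = (\<Sum>m\<in>Poly_Mapping.keys p. Poly_Mapping.single m (Poly_Mapping.lookup p m))"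
  by (rule poly_mapping_eqI)
    (auto simp: lookup_sum lookup_single when_def in_keys_iff sum.delta' if_distrib cong: if_cong)

lemma falling_0 [simp]: "falling 0 n = 1"
  by (simp add: falling_def)

text \<open>Differentiating \<open>i + j\<close> times is differentiating \<open>i\<close> times and
  then \<open>j\<close> times. This arithmetic makes \<open>apolar\<close> an action of the ring of
  operators.\<close>

lemma falling_add: "falling (m + m') n = (falling m n * falling m' (n - m) :: 'k::field)"
proof -
  have *: "fact (i + j) * (k choose (i + j)) = (fact i * (k choose i)) * (fact j * ((k - i) choose j))"
    for i j k :: nat
  proof (cases "i + j \<le> k")
    case True
    \<comment> \<open>Multiplied by \<open>fact (k - (i + j))\<close>, both sides become
      \<open>fact k\<close>.\<close>
    have "fact (i + j) * (k choose (i + j)) * fact (k - (i + j)) = fact k"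
      using binomial_fact_lemma[OF True] by (simp add: ac_simps)
    moreover have "fact i * (k choose i) * fact (k - i) = fact k"
      using binomial_fact_lemma[of i k] True by (simp add: ac_simps)
    moreover have "fact j * ((k - i) choose j) * fact (k - i - j) = fact (k - i)"
      using binomial_fact_lemma[of j "k - i"] True by (simp add: ac_simps)
    ultimately have "fact (i + j) * (k choose (i + j)) * fact (k - (i + j)) =
        (fact i * (k choose i)) * (fact j * ((k - i) choose j)) * fact (k - (i + j))"
      by (metis diff_diff_left mult.assoc)
    then show ?thesis by (metis fact_nonzero mult_right_cancel)
  next
    case False
    then show ?thesis by (cases "i \<le> k") (auto simp: binomial_eq_0)
  qed
  show ?thesis
    unfolding falling_def prod.distrib[symmetric] lookup_add lookup_minus
    by (intro prod.cong refl, subst *) simp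
qed

lemma apolar_single_mult:
  "apolar (Poly_Mapping.single m s * Poly_Mapping.single m' s') (Poly_Mapping.single n t) =
     apolar (Poly_Mapping.single m s) (apolar (Poly_Mapping.single m' s') (Poly_Mapping.single n t))"
proof -
  have "falling (m + m') n = (falling m' n * falling m (n - m') :: 'b)"
    unfolding add.commute[of m] by (rule falling_add)
  then show ?thesis
    by (simp add: mult_single apolar_single diff_diff_add add.commute[of m'] mult.assoc mult.left_commute)
qed

text \<open>By bilinearity the claim reduces to monomials, where it is \<open>falling_add\<close>.
  It makes constant coefficient operators commute.\<close>

lemma apolar_mult: "apolar (x * y) f = apolar x (apolar y f)"
proof -
  have 1: "apolar (Poly_Mapping.single m s * Poly_Mapping.single m' s') f =
     apolar (Poly_Mapping.single m s) (apolar (Poly_Mapping.single m' s') f)" for m s m' s'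
    by (subst (1 2) sym_eq_sum_single[of f]) (simp add: apolar_sum_right apolar_single_mult)
  have 2: "apolar (Poly_Mapping.single m s * y) f = apolar (Poly_Mapping.single m s) (apolar y f)" for m s
    by (subst (1 2) sym_eq_sum_single[of y])
      (simp add: apolar_sum_left apolar_sum_right sum_distrib_left 1)
  show ?thesis
    by (subst (1 2) sym_eq_sum_single[of x]) (simp add: apolar_sum_left sum_distrib_right 2)
qed

lemma apolar_const [simp]: "apolar (const s) f = const s * f"
proof -
  have "apolar (const s) (Poly_Mapping.single n t) = const s * Poly_Mapping.single n t"
    for n :: "'a \<Rightarrow>\<^sub>0 nat" and t
    by (simp add: apolar_single mult_single)
  then show ?thesis
    by (subst (1 2) sym_eq_sum_single[of f]) (simp add: apolar_sum_right sum_distrib_left)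
qed

lemma apolar_numeral [simp]: "apolar (numeral w) f = numeral w * f"
  using apolar_const[of "numeral w" f] by (simp only: single_numeral)

lemma apolar_commute: "apolar x (apolar y f) = apolar y (apolar x f)"
  by (metis apolar_mult mult.commute)

lemma apolar_const_mult_right: "apolar x (const s * f) = const s * apolar x f"
  using apolar_commute[of x "const s" f] by simp

lemma apolar_numeral_mult_right: "apolar x (numeral w * f) = numeral w * apolar x f"
  using apolar_commute[of x "numeral w" f] by simp

lemma falling_indet: "falling (Poly_Mapping.single i (Suc 0)) n = of_nat (Poly_Mapping.lookup n i)"
proof -
  have "falling (Poly_Mapping.single i (Suc 0)) n =
      (\<Prod>j\<in>UNIV. if j = i then of_nat (Poly_Mapping.lookup n i) else 1)"
    unfolding falling_def by (intro prod.cong) (auto simp: lookup_single when_def)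
  then show ?thesis by simp
qed

lemma indet_derivation:
  "apolar (indet i) (f * g) = apolar (indet i) f * g + f * apolar (indet i) g"
proof -
  have 1: "apolar (indet i) (Poly_Mapping.single n s * Poly_Mapping.single n' t) =
     apolar (indet i) (Poly_Mapping.single n s) * Poly_Mapping.single n' t +
     Poly_Mapping.single n s * apolar (indet i) (Poly_Mapping.single n' t)" for n n' s t
  proof -
    let ?e = "Poly_Mapping.single i (Suc 0)"
    \<comment> \<open>Truncated subtraction moves past the sum only if the exponent is positive; if
      it is zero, the factor from \<open>falling_indet\<close> removes the term.\<close>
    have e: "n - ?e + n' = n + n' - ?e" if "Poly_Mapping.lookup n i \<noteq> 0" for n n' :: "'a \<Rightarrow>\<^sub>0 nat"
      using that by (intro poly_mapping_eqI) (auto simp: lookup_add lookup_minus lookup_single when_def)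
    show ?thesis
      using e[of n n'] e[of n' n]
      by (cases "Poly_Mapping.lookup n i = 0"; cases "Poly_Mapping.lookup n' i = 0")
        (auto simp: mult_single apolar_single falling_indet lookup_add algebra_simps
          simp flip: single_add)
  qed
  have 2: "apolar (indet i) (Poly_Mapping.single n s * g) =
     apolar (indet i) (Poly_Mapping.single n s) * g +
     Poly_Mapping.single n s * apolar (indet i) g" for n s
    by (subst (1 2 3) sym_eq_sum_single[of g])
      (simp add: apolar_sum_right sum_distrib_left sum_distrib_right 1 sum.distrib del: One_nat_def)
  show ?thesis
    by (subst (1 2 3) sym_eq_sum_single[of f])
      (simp add: apolar_sum_right sum_distrib_left sum_distrib_right 2 sum.distrib del: One_nat_def)
qed

section \<open>Homogeneous components\<close>

lemma homog_0 [simp]: "0 \<in> homog d"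
  by (simp add: homog_def)

lemma homog_add: "p \<in> homog d \<Longrightarrow> r \<in> homog d \<Longrightarrow> p + r \<in> homog d"
  using Poly_Mapping.keys_add[of p r] by (auto simp: homog_def)

lemma homog_diff: "p \<in> homog d \<Longrightarrow> r \<in> homog d \<Longrightarrow> p - r \<in> homog d"
  using keys_diff[of p r] by (auto simp: homog_def)

lemma homog_sum: "(\<And>i. i \<in> I \<Longrightarrow> g i \<in> homog d) \<Longrightarrow> sum g I \<in> homog d"
  by (induction I rule: infinite_finite_induct) (auto intro: homog_add)

lemma homog_mult: "p \<in> homog d \<Longrightarrow> r \<in> homog e \<Longrightarrow> p * r \<in> homog (d + e)"
  using keys_mult[of p r] by (force simp: homog_def lookup_add sum.distrib)

lemma homog_const [simp]: "const s \<in> homog 0"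
  by (simp add: homog_def)

lemma homog_const_mult: "p \<in> homog d \<Longrightarrow> const s * p \<in> homog d"
  using homog_mult[of "const s" 0 p d] by simp

lemma homog_power: "p \<in> homog d \<Longrightarrow> p ^ k \<in> homog (k * d)"
proof (induction k)
  case 0
  show ?case using homog_const[of 1] by simp
next
  case (Suc k)
  then show ?case using homog_mult[of p d "p ^ k" "k * d"] by simp
qed

lemma homog_0_eq_const:
  assumes "p \<in> homog 0"
  shows "p = const (Poly_Mapping.lookup p 0)"
proof (rule poly_mapping_eqI)
  fix m :: "'a \<Rightarrow>\<^sub>0 nat"
  show "Poly_Mapping.lookup p m = Poly_Mapping.lookup (const (Poly_Mapping.lookup p 0)) m"
  proof (cases "m = 0")
    case False
    then have "(\<Sum>i\<in>UNIV. Poly_Mapping.lookup m i) \<noteq> 0"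
      by (metis (no_types, lifting) UNIV_I finite lookup_zero poly_mapping_eqI sum_eq_0_iff)
    then have "m \<notin> Poly_Mapping.keys p"
      using assms by (auto simp: homog_def simp del: sum_eq_0_iff)
    then show ?thesis
      using False by (simp add: lookup_single when_def in_keys_iff)
  qed simp
qed

lemma homog_0E:
  assumes "p \<in> homog 0"
  obtains s where "p = const s"
  using homog_0_eq_const[OF assms] by blast

lemma homog_apolar:
  assumes x: "x \<in> homog e" and f: "f \<in> homog (e + d)"
  shows "apolar x f \<in> homog d"
proof -
  have "Poly_Mapping.single (n - m)
      (Poly_Mapping.lookup x m * Poly_Mapping.lookup f n * falling m n) \<in> homog d"
    if "m \<in> Poly_Mapping.keys x" "n \<in> Poly_Mapping.keys f" for m n
  proof (cases "\<forall>i. Poly_Mapping.lookup m i \<le> Poly_Mapping.lookup n i")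
    case True
    have "(\<Sum>i\<in>UNIV. Poly_Mapping.lookup (n - m) i) =
        (\<Sum>i\<in>UNIV. Poly_Mapping.lookup n i) - (\<Sum>i\<in>UNIV. Poly_Mapping.lookup m i)"
      unfolding lookup_minus by (rule sum_subtractf_nat) (use True in auto)
    then show ?thesis using that x f by (auto simp: homog_def)
  next
    case False
    then obtain i where "Poly_Mapping.lookup n i < Poly_Mapping.lookup m i" by (auto simp: not_le)
    \<comment> \<open>Truncated subtraction could give a wrong degree here, but the coefficient is
      zero.\<close>
    then have "falling m n = (0 :: 'b)"
      unfolding falling_def by (intro prod_zero) (auto intro!: exI[of _ i] simp: binomial_eq_0)
    then show ?thesis by simp
  qed
  then show ?thesis
    by (subst apolar_superset[of "Poly_Mapping.keys x" _ "Poly_Mapping.keys f"])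
      (auto intro!: homog_sum)
qed

lemma single_Suc_0_eq_iff [simp]:
  "Poly_Mapping.single i (Suc 0) = Poly_Mapping.single j (Suc 0) \<longleftrightarrow> i = j"
  by (metis lookup_single_eq lookup_single_not_eq nat.simps(3))

lemma indet_homog [simp]: "indet i \<in> homog 1"
  by (auto simp: homog_def lookup_single when_def)

lemma homog_1_eq_sum:
  assumes "p \<in> homog 1"
  shows "p = (\<Sum>i\<in>UNIV. const (Poly_Mapping.lookup p (Poly_Mapping.single i 1)) * indet i)"
proof (rule poly_mapping_eqI)
  fix m :: "'a \<Rightarrow>\<^sub>0 nat"
  show "Poly_Mapping.lookup p m = Poly_Mapping.lookup
    (\<Sum>i\<in>UNIV. const (Poly_Mapping.lookup p (Poly_Mapping.single i 1)) * indet i) m"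
  proof (cases "\<exists>i. m = Poly_Mapping.single i 1")
    case True
    then obtain i where "m = Poly_Mapping.single i 1" by blast
    then show ?thesis
      by (simp add: lookup_sum mult_single lookup_single when_def if_distrib cong: if_cong)
  next
    case False
    have "m \<notin> Poly_Mapping.keys p"
    proof
      assume "m \<in> Poly_Mapping.keys p"
      then have *: "(\<Sum>i\<in>UNIV. Poly_Mapping.lookup m i) = 1" using assms by (auto simp: homog_def)
      then obtain i where i: "Poly_Mapping.lookup m i = 1" "\<forall>j. j \<noteq> i \<longrightarrow> Poly_Mapping.lookup m j = 0"
        using sum_eq_1_iff[of UNIV "Poly_Mapping.lookup m"] by auto
      then have "m = Poly_Mapping.single i 1"
        by (intro poly_mapping_eqI) (auto simp: lookup_single when_def)
      with False show False by blast
    qed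
    moreover have "Poly_Mapping.single i (Suc 0) \<noteq> m" for i
      using False by auto
    ultimately show ?thesis
      by (simp add: in_keys_iff lookup_sum mult_single lookup_single when_def)
  qed
qed

section \<open>Leibniz rule and Euler's identity\<close>

lemma derivation:
  assumes "a \<in> homog 1"
  shows "apolar a (f * g) = apolar a f * g + f * apolar a g"
  by (subst (1 2 3) homog_1_eq_sum[OF assms])
    (simp add: apolar_sum_left apolar_mult indet_derivation sum.distrib distrib_left
      sum_distrib_left sum_distrib_right mult.assoc mult.left_commute del: One_nat_def)

lemma derivation_power:
  assumes "a \<in> homog 1"
  shows "apolar a (f ^ Suc n) = of_nat (Suc n) * f ^ n * apolar a f"
  by (induction n) (simp_all add: derivation[OF assms] algebra_simps)

text \<open>Each monomial is an eigenvector of the Euler operator, with its degree as eigenvalue. In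
  characteristic zero this recovers a form of positive degree from its first derivatives.\<close>

lemma euler:
  assumes "f \<in> homog d"
  shows "(\<Sum>i\<in>UNIV. indet i * apolar (indet i) f) = of_nat d * f"
proof -
  have 1: "(\<Sum>i\<in>UNIV. indet i * apolar (indet i) (Poly_Mapping.single n t)) =
      of_nat d * Poly_Mapping.single n t" if "(\<Sum>i\<in>UNIV. Poly_Mapping.lookup n i) = d" for n and t :: 'b
  proof -
    have "indet i * apolar (indet i) (Poly_Mapping.single n t) =
        of_nat (Poly_Mapping.lookup n i) * Poly_Mapping.single n t" for i
    proof (cases "Poly_Mapping.lookup n i")
      case (Suc k)
      then have "Poly_Mapping.single i (Suc 0) + (n - Poly_Mapping.single i (Suc 0)) = n"
        by (intro poly_mapping_eqI) (auto simp: lookup_add lookup_minus lookup_single when_def)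
      then show ?thesis
        by (simp add: apolar_single falling_indet mult_single mult.commute flip: single_of_nat)
    qed (simp add: apolar_single falling_indet)
    then show ?thesis
      by (simp add: that[symmetric] sum_distrib_right)
  qed
  have "(\<Sum>i\<in>UNIV. indet i * apolar (indet i) f) =
      (\<Sum>n\<in>Poly_Mapping.keys f. \<Sum>i\<in>UNIV. indet i *
          apolar (indet i) (Poly_Mapping.single n (Poly_Mapping.lookup f n)))"
    by (subst sym_eq_sum_single[of f])
      (simp add: apolar_sum_right sum_distrib_left sum.swap[of _ UNIV] del: One_nat_def)
  also have "\<dots> = (\<Sum>n\<in>Poly_Mapping.keys f. of_nat d * Poly_Mapping.single n (Poly_Mapping.lookup f n))"
    by (intro sum.cong refl 1) (use assms in \<open>auto simp: homog_def\<close>)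
  also have "\<dots> = of_nat d * f"
    by (simp flip: sum_distrib_left sym_eq_sum_single)
  finally show ?thesis .
qed

section \<open>Binary forms in dual coordinates\<close>

lemma span_singleton_const: "sym.span {F} = range (\<lambda>s. const s * F)"
  by (simp add: sym.span_singleton scale_def)

text \<open>One statement serves both kinds of projective points: \<open>g\<close> is the identity
  for spans and \<open>qclass a\<close> for lines in the quotient.\<close>

lemma range_const_mult:
  assumes "s \<noteq> 0"
  shows "range (\<lambda>t. g (const t * (const s * (h :: ('n, 'k::field) sym)))) = range (\<lambda>t. g (const t * h))"
proof -
  have *: "const t * (const s * h) = const (t * s) * h" "const t * h = const (t / s) * (const s * h)" for t
    using assms by (simp_all add: mult_single flip: mult.assoc)
  show ?thesis
  proof (intro equalityI image_subsetI)
    show "g (const t * (const s * h)) \<in> range (\<lambda>t. g (const t * h))" for t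
      unfolding *(1) by (rule rangeI)
    show "g (const t * h) \<in> range (\<lambda>t. g (const t * (const s * h)))" for t
      unfolding *(2)[of t] by (rule rangeI)
  qed
qed

lemma span_const_mult: "s \<noteq> 0 \<Longrightarrow> sym.span {const s * F} = sym.span {F}"
  unfolding span_singleton_const by (rule range_const_mult)

lemma qclass_eq_iff: "qclass a p = qclass a r \<longleftrightarrow> a dvd p - r"
proof
  assume "qclass a p = qclass a r"
  moreover have "p \<in> qclass a p" by (simp add: qclass_def)
  ultimately show "a dvd p - r" by (simp add: qclass_def)
next
  assume *: "a dvd p - r"
  have "a dvd s - p \<longleftrightarrow> a dvd s - r" for s
    using dvd_add[OF _ *, of "s - p"] dvd_diff[OF _ *, of "s - r"] by auto
  then show "qclass a p = qclass a r" by (simp add: qclass_def)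
qed

lemma qclass_self: "p \<in> qclass a p"
  by (simp add: qclass_def)

lemma qscale_qclass: "qscale a s (qclass a p) = qclass a (const s * p)"
proof -
  have "qclass a (scale s r) = qclass a (const s * p)" if "r \<in> qclass a p" for r
    using that
    by (auto simp: qclass_eq_iff qclass_def[of a p] scale_def simp flip: right_diff_distrib)
  then show ?thesis
    unfolding qscale_def using qclass_self[of p a] by blast
qed

lemma apolar_dvd_eq_0: "apolar a F = 0 \<Longrightarrow> a dvd p \<Longrightarrow> apolar p F = 0"
  by (elim dvdE) (simp add: apolar_mult apolar_commute[of a])

text \<open>Multiples of \<open>a\<close> act as zero on \<open>F\<close>, so all representatives
  give one value and \<open>the_elem\<close> in \<open>qapolar_def\<close> reads it off.\<close>

lemma qapolar_qclass:
  assumes "apolar a F = 0"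
  shows "qapolar (qclass a p) F = apolar p F"
proof -
  have "apolar r F = apolar p F" if "r \<in> qclass a p" for r
    using apolar_dvd_eq_0[OF assms, of "r - p"] that by (simp add: qclass_def apolar_diff_left)
  then have "(\<lambda>r. apolar r F) ` qclass a p = {apolar p F}"
    using qclass_self[of p a] by blast
  then show ?thesis by (simp add: qapolar_def)
qed

text \<open>Parametrised by a representative, so that later arguments work with operators instead of
  cosets.\<close>

definition qline :: "('n, 'k::field) sym \<Rightarrow> ('n, 'k) sym \<Rightarrow> ('n, 'k) sym set set" where
  "qline a h = range (\<lambda>s. qclass a (const s * h))"

lemma qline_cong: "a dvd h - h' \<Longrightarrow> qline a h = qline a h'"
proof -
  assume "a dvd h - h'"
  then have "qclass a (const s * h) = qclass a (const s * h')" for s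
    by (simp add: qclass_eq_iff flip: right_diff_distrib)
  then show ?thesis by (simp add: qline_def)
qed

lemma qline_const_mult: "s \<noteq> 0 \<Longrightarrow> qline a (const s * h) = qline a h"
  unfolding qline_def by (rule range_const_mult)

lemma qapolar_qline_eq_0_iff:
  assumes "apolar a F = 0"
  shows "(\<forall>X\<in>qline a h. qapolar X F = 0) \<longleftrightarrow> apolar h F = 0"
proof
  assume "\<forall>X\<in>qline a h. qapolar X F = 0"
  then have "qapolar (qclass a (const 1 * h)) F = 0"
    unfolding qline_def by blast
  then show "apolar h F = 0" by (simp add: qapolar_qclass assms)
next
  assume "apolar h F = 0"
  then show "\<forall>X\<in>qline a h. qapolar X F = 0"
    by (auto simp: qline_def qapolar_qclass assms apolar_mult)
qed

text \<open>In equal degrees \<open>apolar h q\<close> is a constant, so a zero pairing already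
  means \<open>apolar h q = 0\<close>. A class is zero exactly when \<open>a\<close> divides its
  representatives.\<close>

lemma qproj_qperp:
  assumes q: "q \<in> kercomp a d"
  shows "qproj a (qperp a d q) = {qline a h | h. h \<in> homog d \<and> apolar h q = 0 \<and> \<not> a dvd h}"
proof -
  have 1: "(\<forall>F\<in>sym.span {q}. qpairing (qclass a h) F = 0) \<longleftrightarrow> apolar h q = 0"
    if h: "h \<in> homog d" for h
  proof -
    have aq: "apolar a q = 0" using q by (simp add: kercomp_def)
    have "apolar h q \<in> homog 0"
      by (rule homog_apolar[of _ d]) (use q h in \<open>simp_all add: kercomp_def\<close>)
    then obtain t where t: "apolar h q = const t" by (rule homog_0E)
    have *: "qpairing (qclass a h) (const s * q) = s * t" for s
      by (simp add: qpairing_def qapolar_qclass apolar_const_mult_right aq t mult_single)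
    show ?thesis
      unfolding span_singleton_const by (auto simp: * t)
  qed
  have 2: "qclass a h \<noteq> qclass a 0 \<longleftrightarrow> \<not> a dvd h" for h
    by (simp add: qclass_eq_iff)
  have 3: "range (\<lambda>s. qscale a s (qclass a h)) = qline a h" for h
    by (simp add: qscale_qclass qline_def)
  show ?thesis
  proof (intro equalityI subsetI)
    fix P assume "P \<in> qproj a (qperp a d q)"
    then obtain X where X: "P = range (\<lambda>s. qscale a s X)" "X \<in> qperp a d q" "X \<noteq> qclass a 0"
      unfolding qproj_def by blast
    moreover obtain h where h: "X = qclass a h" "h \<in> homog d"
      using X(2) by (auto simp: qperp_def qcomp_def)
    moreover have "apolar h q = 0"
      using X(2) 1[OF h(2)] by (simp add: qperp_def h(1))
    ultimately show "P \<in> {qline a h | h. h \<in> homog d \<and> apolar h q = 0 \<and> \<not> a dvd h}"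
      using 2[of h] 3[of h] by blast
  next
    fix P assume "P \<in> {qline a h | h. h \<in> homog d \<and> apolar h q = 0 \<and> \<not> a dvd h}"
    then obtain h where h: "P = qline a h" "h \<in> homog d" "apolar h q = 0" "\<not> a dvd h" by blast
    then have "qclass a h \<in> qperp a d q"
      using 1[OF h(2)] by (simp add: qperp_def qcomp_def)
    then show "P \<in> qproj a (qperp a d q)"
      unfolding qproj_def using h(1,4) 2[of h] 3[of h] by blast
  qed
qed

lemma kercomp_add: "F \<in> kercomp a d \<Longrightarrow> G \<in> kercomp a d \<Longrightarrow> F + G \<in> kercomp a d"
  by (simp add: kercomp_def homog_add apolar_add_right)

lemma kercomp_diff: "F \<in> kercomp a d \<Longrightarrow> G \<in> kercomp a d \<Longrightarrow> F - G \<in> kercomp a d"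
  by (simp add: kercomp_def homog_diff apolar_diff_right)

lemma kercomp_const_mult: "F \<in> kercomp a d \<Longrightarrow> const s * F \<in> kercomp a d"
  by (simp add: kercomp_def homog_const_mult apolar_const_mult_right)

lemma kercomp_apolar:
  "x \<in> homog 1 \<Longrightarrow> F \<in> kercomp a (Suc d) \<Longrightarrow> apolar x F \<in> kercomp a d"
  using homog_apolar[of x 1 F d] by (simp add: kercomp_def apolar_commute[of a])

lemma kercomp_mult:
  "a \<in> homog 1 \<Longrightarrow> F \<in> kercomp a d \<Longrightarrow> G \<in> kercomp a e \<Longrightarrow> F * G \<in> kercomp a (d + e)"
  by (simp add: kercomp_def homog_mult derivation)

lemma kercomp_power:
  "a \<in> homog 1 \<Longrightarrow> F \<in> kercomp a d \<Longrightarrow> F ^ k \<in> kercomp a (k * d)"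
  using derivation_power[of a F "k - 1"] derivation[of a 1 1] homog_power[of F d k]
  by (cases k) (auto simp: kercomp_def)

lemma derivation_const:
  assumes "a \<in> homog 1"
  shows "apolar a (const s) = 0"
  using derivation[OF assms, of 1 1] apolar_const_mult_right[of a s 1] by simp

text \<open>
  Euler's identity for the frame stands in for the statement that both triples are bases: it
  expresses a form in the frame through its derivatives, with no change of variables.
\<close>

locale apolar_frame =
  fixes a b c ya yb yc :: "('n::finite, 'k::field_char_0) sym"
  assumes deg: "a \<in> homog 1" "b \<in> homog 1" "c \<in> homog 1"
      "ya \<in> homog 1" "yb \<in> homog 1" "yc \<in> homog 1"
    and dual [simp]: "apolar a ya = 1" "apolar a yb = 0" "apolar a yc = 0"
      "apolar b ya = 0" "apolar b yb = 1" "apolar b yc = 0"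
      "apolar c ya = 0" "apolar c yb = 0" "apolar c yc = 1"
    and euler_lower: "f \<in> homog d \<Longrightarrow>
      ya * apolar a f + yb * apolar b f + yc * apolar c f = of_nat d * f"
    and euler_upper: "h \<in> homog d \<Longrightarrow>
      a * apolar ya h + b * apolar yb h + c * apolar yc h = of_nat d * h"
begin

text \<open>Through this swap every result on the space L_a, the source side of
  \<open>theta\<close>, is also one on L_b, its target side.\<close>

lemma swap_ab: "apolar_frame b a c yb ya yc"
  by unfold_locales (use deg euler_lower euler_upper in \<open>auto simp: add.commute add.left_commute\<close>)

lemmas frame_derivation = deg(1-3)[THEN derivation] deg(1-3)[THEN derivation_const]
  apolar_add_right apolar_diff_right
  apolar_const_mult_right apolar_numeral_mult_right

lemma of_nat_mult_eq: "of_nat (Suc d) * F = G \<Longrightarrow> F = const (1 / of_nat (Suc d)) * G"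
  for F G :: "('n, 'k) sym"
proof -
  assume "of_nat (Suc d) * F = G"
  then have "const (1 / of_nat (Suc d)) * G = const (1 / of_nat (Suc d)) * const (of_nat (Suc d)) * F"
    unfolding single_of_nat by (simp only: mult.assoc)
  also have "const (1 / of_nat (Suc d)) * const (of_nat (Suc d)) = (1 :: ('n, 'k) sym)"
    by (simp add: mult_single del: of_nat_Suc single_of_nat)
  finally show ?thesis by simp
qed

text \<open>With the derivatives along \<open>a\<close> and \<open>b\<close> zero, Euler's identity
  leaves only \<open>yc\<close> times the derivative along \<open>c\<close>, and induction on the
  degree applies to that derivative.\<close>

lemma yc_power:
  assumes "F \<in> kercomp a d" "apolar b F = 0"
  shows "\<exists>t. F = const t * yc ^ d"
  using assms
proof (induction d arbitrary: F)
  case 0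
  then show ?case by (auto simp: kercomp_def elim: homog_0E)
next
  case (Suc d)
  have "apolar c F \<in> kercomp a d" by (rule kercomp_apolar) (use Suc.prems deg in auto)
  moreover have "apolar b (apolar c F) = 0" using Suc.prems by (simp add: apolar_commute[of b])
  ultimately obtain t where t: "apolar c F = const t * yc ^ d" using Suc.IH by blast
  have "yc * apolar c F = of_nat (Suc d) * F"
    using euler_lower[of F "Suc d"] Suc.prems by (simp add: kercomp_def)
  then have "F = const (1 / of_nat (Suc d)) * (yc * apolar c F)"
    by (intro of_nat_mult_eq) simp
  then have "F = const (1 / of_nat (Suc d) * t) * yc ^ Suc d"
    unfolding t const_mult power_Suc by (simp only: mult.assoc mult.left_commute)
  then show ?case by blast
qed

lemma linear_form_eq_0:
  assumes "const s * yb + const t * yc = 0"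
  shows "s = 0" "t = 0"
  using arg_cong[OF assms, of "apolar b"] arg_cong[OF assms, of "apolar c"] by (simp_all add: frame_derivation)

lemma linear_form:
  assumes "u \<in> kercomp a 1"
  obtains s t where "u = const s * yb + const t * yc"
proof -
  have u: "u \<in> homog 1" "apolar a u = 0" using assms by (auto simp: kercomp_def)
  obtain s where s: "apolar b u = const s" using homog_apolar[of b 1 u 0] deg u by (auto elim: homog_0E)
  obtain t where t: "apolar c u = const t" using homog_apolar[of c 1 u 0] deg u by (auto elim: homog_0E)
  show ?thesis
    by (rule that[of s t]) (use euler_lower[OF u(1)] s t u in \<open>simp add: mult.commute\<close>)
qed

text \<open>The binomial factor 2 makes the pairing with \<open>op\<close> twice the dot product of
  the coefficient triples, and \<open>q0 * q2 - q1 ^ 2\<close> the discriminant up to a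
  scalar.\<close>

definition quad :: "'k \<Rightarrow> 'k \<Rightarrow> 'k \<Rightarrow> ('n, 'k) sym" where
  "quad q0 q1 q2 = const q0 * yb ^ 2 + 2 * const q1 * (yb * yc) + const q2 * yc ^ 2"

definition op :: "'k \<Rightarrow> 'k \<Rightarrow> 'k \<Rightarrow> ('n, 'k) sym" where
  "op h0 h1 h2 = const h0 * b ^ 2 + const h1 * (b * c) + const h2 * c ^ 2"

text \<open>Coordinates on L_a: \<open>m\<close> scales a chosen primitive of the quadric along
  \<open>b\<close>, and \<open>t\<close> scales the cube of \<open>yc\<close>, which spans the
  cubics killed by both \<open>a\<close> and \<open>b\<close>.\<close>

definition cub :: "'k \<Rightarrow> 'k \<Rightarrow> 'k \<Rightarrow> 'k \<Rightarrow> 'k \<Rightarrow> ('n, 'k) sym" where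
  "cub q0 q1 q2 m t =
     const m * (const q0 * yb ^ 3 + 3 * const q1 * (yb ^ 2 * yc) + 3 * const q2 * (yb * yc ^ 2))
     + const t * yc ^ 3"

lemma kercomp_y: "yb \<in> kercomp a 1" "yc \<in> kercomp a 1"
  using deg by (simp_all add: kercomp_def)

lemma quad_kercomp: "quad q0 q1 q2 \<in> kercomp a 2"
  using kercomp_mult[OF deg(1) kercomp_y(1) kercomp_y(1)]
    kercomp_mult[OF deg(1) kercomp_y(1) kercomp_y(2)]
    kercomp_mult[OF deg(1) kercomp_y(2) kercomp_y(2)]
    kercomp_const_mult[of _ a 2 2]
  unfolding quad_def
  by (auto simp: power2_eq_square mult.assoc numeral_2_eq_2 simp del: mult_2 intro!: kercomp_add kercomp_const_mult)

lemma quad_form: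
  assumes q: "q \<in> kercomp a 2"
  obtains q0 q1 q2 where "q = quad q0 q1 q2"
proof -
  have k: "apolar b q \<in> kercomp a 1" "apolar c q \<in> kercomp a 1"
    using kercomp_apolar[of _ q a 1] q deg by (auto simp: numeral_2_eq_2)
  obtain s t where 1: "apolar b q = const s * yb + const t * yc"
    by (rule linear_form[OF k(1)])
  obtain s' t' where 2: "apolar c q = const s' * yb + const t' * yc"
    by (rule linear_form[OF k(2)])
  note * = 1 2
  \<comment> \<open>Both are the mixed derivative along \<open>b\<close> and
    \<open>c\<close>.\<close>
  have "const s' = const t"
    using apolar_commute[of b c q] unfolding * by (simp add: frame_derivation)
  then have **: "s' = t" by simp
  have "of_nat (Suc 1) * q = yb * apolar b q + yc * apolar c q"
    using euler_lower[of q 2] q by (simp add: kercomp_def)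
  then have "q = const (1 / of_nat (Suc 1)) * (yb * apolar b q + yc * apolar c q)"
    by (rule of_nat_mult_eq)
  also have "\<dots> = quad (s / 2) (t / 2) (t' / 2)"
  proof -
    have e: "const (r / 2) = const (1/2) * (const r :: ('n, 'k) sym)" for r
      by (simp add: mult_single)
    have "K * (y * (S * y + T * z) + z * (T * y + T' * z)) =
        K * S * y ^ 2 + 2 * (K * T) * (y * z) + K * T' * z ^ 2" for K S T T' y z :: "('n, 'k) sym"
      by (simp add: algebra_simps power2_eq_square)
    then show ?thesis unfolding * ** quad_def e[of s] e[of t] e[of t'] by simp
  qed
  finally show ?thesis by (rule that)
qed

lemma op_homog: "op h0 h1 h2 \<in> homog 2"
  using homog_mult[OF deg(2) deg(2)] homog_mult[OF deg(2) deg(3)] homog_mult[OF deg(3) deg(3)]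
  by (auto simp: op_def power2_eq_square numeral_2_eq_2 intro!: homog_add homog_const_mult)

text \<open>Euler's identity for operators, applied to \<open>h\<close> and to its derivatives,
  expands \<open>h\<close> in \<open>a\<close>, \<open>b\<close>, \<open>c\<close>; the terms with a
  factor \<open>a\<close> are split off.\<close>

lemma op_form:
  assumes h: "h \<in> homog 2"
  obtains h0 h1 h2 where "a dvd h - op h0 h1 h2"
proof -
  have lin: "\<exists>s t w. p = const s * b + const t * c + a * w" if p: "p \<in> homog 1" for p
  proof -
    obtain s where s: "apolar yb p = const s" using homog_apolar[of yb 1 p 0] deg p by (auto elim: homog_0E)
    obtain t where t: "apolar yc p = const t" using homog_apolar[of yc 1 p 0] deg p by (auto elim: homog_0E)
    have "p = const s * b + const t * c + a * apolar ya p"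
      using euler_upper[OF p] s t by (simp add: algebra_simps)
    then show ?thesis by blast
  qed
  have k: "apolar yb h \<in> homog 1" "apolar yc h \<in> homog 1"
    using homog_apolar[of _ 1 h 1] h deg by (auto simp: numeral_2_eq_2)
  obtain s t w where 1: "apolar yb h = const s * b + const t * c + a * w"
    using lin[OF k(1)] by blast
  obtain s' t' w' where 2: "apolar yc h = const s' * b + const t' * c + a * w'"
    using lin[OF k(2)] by blast
  note * = 1 2
  have "of_nat (Suc 1) * h = a * apolar ya h + b * apolar yb h + c * apolar yc h"
    using euler_upper[of h 2] h by simp
  then have "h = const (1 / of_nat (Suc 1)) * (a * apolar ya h + b * apolar yb h + c * apolar yc h)"
    by (rule of_nat_mult_eq)
  also have "\<dots> = const (1/2) * (const s * b ^ 2 + const (t + s') * (b * c) + const t' * c ^ 2)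
      + a * (const (1/2) * (apolar ya h + b * w + c * w'))"
    unfolding * by (simp add: algebra_simps power2_eq_square single_add)
  also have "\<dots> = op (s / 2) ((t + s') / 2) (t' / 2) + a * (const (1/2) * (apolar ya h + b * w + c * w'))"
  proof -
    have e: "const (r / 2) = const (1/2) * (const r :: ('n, 'k) sym)" for r
      by (simp add: mult_single)
    show ?thesis by (simp only: op_def e[of s] e[of "t + s'"] e[of t'] distrib_left mult.assoc)
  qed
  finally have "h - op (s / 2) ((t + s') / 2) (t' / 2) =
      a * (const (1/2) * (apolar ya h + b * w + c * w'))"
    by (simp only: diff_eq_eq add.commute)
  then show ?thesis by (intro that dvdI)
qed

lemma apolar_op_quad: "apolar (op h0 h1 h2) (quad q0 q1 q2) = const (2 * (h0 * q0 + h1 * q1 + h2 * q2))"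
  by (simp add: op_def quad_def apolar_add_left apolar_mult power2_eq_square frame_derivation)
    (simp add: const_mult single_add algebra_simps)

text \<open>Divisibility is tested by pairing: a multiple of \<open>a\<close> annihilates every
  \<open>quad\<close>, and three coordinate quadrics detect the coefficients of the
  operator.\<close>

lemma dvd_op_iff: "a dvd op h0 h1 h2 \<longleftrightarrow> h0 = 0 \<and> h1 = 0 \<and> h2 = 0"
proof
  assume *: "a dvd op h0 h1 h2"
  have "apolar (op h0 h1 h2) (quad q0 q1 q2) = 0" for q0 q1 q2
    by (rule apolar_dvd_eq_0[OF _ *]) (use quad_kercomp in \<open>simp add: kercomp_def\<close>)
  then have **: "2 * (h0 * q0 + h1 * q1 + h2 * q2) = 0" for q0 q1 q2
    by (metis apolar_op_quad const_eq_0_iff)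
  show "h0 = 0 \<and> h1 = 0 \<and> h2 = 0"
    using **[of 1 0 0] **[of 0 1 0] **[of 0 0 1] by simp
qed (simp add: op_def)

lemma op_scale: "op (s * h0) (s * h1) (s * h2) = const s * op h0 h1 h2"
  by (simp add: op_def const_mult algebra_simps)

text \<open>\<open>op_form\<close> supplies representatives and \<open>dvd_op_iff\<close> tells
  which are nonzero. From here on, points of this projective line are handled as coefficient
  triples.\<close>

lemma qproj_qperp_quad:
  "P \<in> qproj a (qperp a 2 (quad q0 q1 q2)) \<longleftrightarrow>
    (\<exists>h0 h1 h2. P = qline a (op h0 h1 h2) \<and> h0 * q0 + h1 * q1 + h2 * q2 = 0
      \<and> \<not> (h0 = 0 \<and> h1 = 0 \<and> h2 = 0))"
proof
  assume "P \<in> qproj a (qperp a 2 (quad q0 q1 q2))"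
  then obtain h where h: "P = qline a h" "h \<in> homog 2" "apolar h (quad q0 q1 q2) = 0" "\<not> a dvd h"
    unfolding qproj_qperp[OF quad_kercomp] by blast
  obtain h0 h1 h2 where d: "a dvd h - op h0 h1 h2" using op_form[OF h(2)] by blast
  have "apolar (h - op h0 h1 h2) (quad q0 q1 q2) = 0"
    by (rule apolar_dvd_eq_0[OF _ d]) (use quad_kercomp in \<open>simp add: kercomp_def\<close>)
  then have "h0 * q0 + h1 * q1 + h2 * q2 = 0"
    by (simp add: apolar_diff_left h(3) apolar_op_quad del: distrib_left_numeral)
  moreover have "\<not> a dvd op h0 h1 h2"
    using h(4) dvd_add[OF d, of "op h0 h1 h2"] by auto
  ultimately show "\<exists>h0 h1 h2. P = qline a (op h0 h1 h2) \<and> h0 * q0 + h1 * q1 + h2 * q2 = 0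
      \<and> \<not> (h0 = 0 \<and> h1 = 0 \<and> h2 = 0)"
    using qline_cong[OF d] h(1) by (auto simp: dvd_op_iff)
next
  assume "\<exists>h0 h1 h2. P = qline a (op h0 h1 h2) \<and> h0 * q0 + h1 * q1 + h2 * q2 = 0
      \<and> \<not> (h0 = 0 \<and> h1 = 0 \<and> h2 = 0)"
  then show "P \<in> qproj a (qperp a 2 (quad q0 q1 q2))"
    unfolding qproj_qperp[OF quad_kercomp]
    by (auto simp: op_homog apolar_op_quad dvd_op_iff)
qed

section \<open>Coordinates on the space L_a of cubics\<close>

lemma cub_kercomp: "cub q0 q1 q2 m t \<in> kercomp a 3"
proof -
  have "yb ^ 3 \<in> kercomp a 3" "yb ^ 2 * yc \<in> kercomp a 3" "yb * yc ^ 2 \<in> kercomp a 3"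
      "yc ^ 3 \<in> kercomp a 3"
    using kercomp_power[OF deg(1) kercomp_y(1), of 3] kercomp_power[OF deg(1) kercomp_y(2), of 3]
      kercomp_mult[OF deg(1) kercomp_power[OF deg(1) kercomp_y(1), of 2] kercomp_y(2)]
      kercomp_mult[OF deg(1) kercomp_y(1) kercomp_power[OF deg(1) kercomp_y(2), of 2]]
    by (simp_all add: numeral_3_eq_3)
  then show ?thesis
    using kercomp_const_mult[of _ a 3 3] unfolding cub_def
    by (auto simp: mult.assoc intro!: kercomp_add kercomp_const_mult)
qed

lemma apolar_b_cub: "apolar b (cub q0 q1 q2 m t) = const (3 * m) * quad q0 q1 q2"
  by (simp add: cub_def quad_def power2_eq_square power3_eq_cube frame_derivation)
    (simp add: const_mult algebra_simps)

text \<open>The coefficient of \<open>yb\<close> contains the pairing with the quadric. For an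
  operator orthogonal to it, killing the cubic is thus one condition, bilinear in the operator and
  in \<open>(m, t)\<close>.\<close>

lemma apolar_op_cub: "apolar (op h0 h1 h2) (cub q0 q1 q2 m t) =
    const (6 * m * (h0 * q0 + h1 * q1 + h2 * q2)) * yb +
    const (6 * (m * (h0 * q1 + h1 * q2) + t * h2)) * yc"
  by (simp add: op_def cub_def apolar_add_left apolar_mult power2_eq_square power3_eq_cube frame_derivation)
    (simp add: const_mult single_add algebra_simps)

lemma cub_scale: "cub q0 q1 q2 (s * m) (s * t) = const s * cub q0 q1 q2 m t"
  by (simp add: cub_def const_mult algebra_simps)

lemma cub_eq_0_iff:
  assumes "\<not> (q0 = 0 \<and> q1 = 0 \<and> q2 = 0)"
  shows "cub q0 q1 q2 m t = 0 \<longleftrightarrow> m = 0 \<and> t = 0"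
proof
  assume *: "cub q0 q1 q2 m t = 0"
  have **: "6 * m * (h0 * q0 + h1 * q1 + h2 * q2) = 0" "6 * (m * (h0 * q1 + h1 * q2) + t * h2) = 0"
    for h0 h1 h2
    using linear_form_eq_0[of "6 * m * (h0 * q0 + h1 * q1 + h2 * q2)" "6 * (m * (h0 * q1 + h1 * q2) + t * h2)"]
    by (metis * apolar_op_cub apolar_0_right)+
  show "m = 0 \<and> t = 0"
    using **(1)[of 1 0 0] **(1)[of 0 1 0] **(1)[of 0 0 1] **(2)[of 0 0 1] assms by auto
qed (simp add: cub_def)

lemma Lspace_quad: "F \<in> Lspace a b (quad q0 q1 q2) \<longleftrightarrow> (\<exists>m t. F = cub q0 q1 q2 m t)"
proof
  assume "F \<in> Lspace a b (quad q0 q1 q2)"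
  then obtain s where F: "F \<in> kercomp a 3" "apolar b F = const s * quad q0 q1 q2"
    by (auto simp: Lspace_def span_singleton_const)
  \<comment> \<open>The factor \<open>1 / 3\<close> compensates the 3 in
    \<open>apolar_b_cub\<close>, so the difference is killed by both \<open>a\<close> and
    \<open>b\<close>.\<close>
  then have "\<exists>t. F - cub q0 q1 q2 (s / 3) 0 = const t * yc ^ 3"
    by (intro yc_power kercomp_diff cub_kercomp) (simp_all add: apolar_diff_right apolar_b_cub)
  then obtain t where "F = cub q0 q1 q2 (s / 3) 0 + const t * yc ^ 3"
    by (metis add.commute diff_add_cancel)
  then have "F = cub q0 q1 q2 (s / 3) t" by (simp add: cub_def)
  then show "\<exists>m t. F = cub q0 q1 q2 m t" by blast
next
  assume "\<exists>m t. F = cub q0 q1 q2 m t"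
  then show "F \<in> Lspace a b (quad q0 q1 q2)"
    by (auto simp: Lspace_def cub_kercomp apolar_b_cub span_singleton_const)
qed

end

section \<open>The maps omega and theta\<close>

text \<open>The matrix with rows \<open>(q0, q1)\<close> and \<open>(q1, q2)\<close> is the
  catalecticant of the quadric. Multiplication by its adjugate shows that its kernel is
  zero.\<close>

lemma disc_kernel_trivial:
  fixes q0 q1 q2 :: "'k::field"
  assumes disc: "q0 * q2 \<noteq> q1\<^sup>2" and k: "k0 * q0 + k1 * q1 = 0" "k0 * q1 + k1 * q2 = 0"
  shows "k0 = 0 \<and> k1 = 0"
proof -
  have "k0 * (q0 * q2 - q1\<^sup>2) = q2 * (k0 * q0 + k1 * q1) - q1 * (k0 * q1 + k1 * q2)"
      "k1 * (q0 * q2 - q1\<^sup>2) = q0 * (k0 * q1 + k1 * q2) - q1 * (k0 * q0 + k1 * q1)"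
    by (simp_all add: algebra_simps power2_eq_square)
  then have "k0 * (q0 * q2 - q1\<^sup>2) = 0" "k1 * (q0 * q2 - q1\<^sup>2) = 0"
    by (simp_all only: k mult_zero_right diff_zero)
  then show ?thesis using disc by simp
qed

lemma killing_op_exists:
  fixes q0 q1 q2 m t :: "'k::field"
  assumes disc: "q0 * q2 \<noteq> q1\<^sup>2" and mt: "\<not> (m = 0 \<and> t = 0)"
  shows "\<exists>h0 h1 h2. h0 * q0 + h1 * q1 + h2 * q2 = 0 \<and> m * (h0 * q1 + h1 * q2) + t * h2 = 0
     \<and> \<not> (h0 = 0 \<and> h1 = 0 \<and> h2 = 0)"
proof (intro exI conjI)
  \<comment> \<open>the cross product of \<open>(q0, q1, q2)\<close> and \<open>(m * q1, m * q2, t)\<close>\<close>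
  let ?h0 = "q1 * t - m * q2\<^sup>2" and ?h1 = "m * q1 * q2 - q0 * t" and ?h2 = "m * (q0 * q2 - q1\<^sup>2)"
  show "?h0 * q0 + ?h1 * q1 + ?h2 * q2 = 0" "m * (?h0 * q1 + ?h1 * q2) + t * ?h2 = 0"
    by (simp_all add: algebra_simps power2_eq_square)
  \<comment> \<open>For \<open>m = 0\<close> the first two entries are \<open>q1 * t\<close> and
    \<open>- q0 * t\<close>; otherwise the third is a nonzero multiple of the discriminant.\<close>
  show "\<not> (?h0 = 0 \<and> ?h1 = 0 \<and> ?h2 = 0)"
  proof (cases "m = 0")
    case True
    then show ?thesis using mt disc by auto
  next
    case False
    then show ?thesis using disc by auto
  qed
qed

text \<open>For nonzero discriminant the two linear conditions on a triple are independent, so their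
  solutions form a line. This yields injectivity of \<open>omega\<close>.\<close>

lemma killing_op_unique:
  fixes q0 q1 q2 m t :: "'k::field"
  assumes disc: "q0 * q2 \<noteq> q1\<^sup>2" and mt: "\<not> (m = 0 \<and> t = 0)"
    and h: "h0 * q0 + h1 * q1 + h2 * q2 = 0" "m * (h0 * q1 + h1 * q2) + t * h2 = 0"
      "\<not> (h0 = 0 \<and> h1 = 0 \<and> h2 = 0)"
    and h': "h0' * q0 + h1' * q1 + h2' * q2 = 0" "m * (h0' * q1 + h1' * q2) + t * h2' = 0"
      "\<not> (h0' = 0 \<and> h1' = 0 \<and> h2' = 0)"
  shows "\<exists>s. s \<noteq> 0 \<and> h0' = s * h0 \<and> h1' = s * h1 \<and> h2' = s * h2"
proof (cases "m = 0")
  case True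
  then have z: "h2 = 0" "h2' = 0" "h0 * q0 + h1 * q1 = 0" "h0' * q0 + h1' * q1 = 0"
    using mt h h' by auto
  have q: "q0 \<noteq> 0 \<or> q1 \<noteq> 0" using disc by auto
  have cross: "h0 * h1' = h1 * h0'"
  proof -
    have "q0 * (h0 * h1' - h1 * h0') = h1' * (h0 * q0 + h1 * q1) - h1 * (h0' * q0 + h1' * q1)"
        "q1 * (h0 * h1' - h1 * h0') = h0 * (h0' * q0 + h1' * q1) - h0' * (h0 * q0 + h1 * q1)"
      by (simp_all add: algebra_simps)
    then have "q0 * (h0 * h1' - h1 * h0') = 0" "q1 * (h0 * h1' - h1 * h0') = 0"
      by (simp_all only: z mult_zero_right diff_zero)
    then show ?thesis using q by auto
  qed
  show ?thesis
  proof (cases "h0 = 0")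
    case True
    then have "h0' = 0" "h1 \<noteq> 0" "h1' \<noteq> 0" using z(1,2) h(3) h'(3) cross by auto
    then show ?thesis
      using z(1,2) True by (intro exI[of _ "h1' / h1"]) simp
  next
    case False
    have "h1' = h0 * h1' / h0" using False by simp
    also have "\<dots> = h0' / h0 * h1" unfolding cross by simp
    finally have h1': "h1' = h0' / h0 * h1" .
    then have "h0' \<noteq> 0" using z(2) h'(3) by auto
    then show ?thesis
      using z(1,2) False h1' by (intro exI[of _ "h0' / h0"]) simp
  qed
next
  case False
  note key = disc_kernel_trivial[OF disc]
  \<comment> \<open>If \<open>h2\<close> were zero, \<open>(h0, h1)\<close> would lie in the kernel
    of the catalecticant.\<close>
  have "h2 \<noteq> 0" using key[of h0 h1] h False by auto
  have "h2' \<noteq> 0" using key[of h0' h1'] h' False by auto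
  define s where "s = h2' / h2"
  have s: "s \<noteq> 0" "h2' = s * h2" using \<open>h2 \<noteq> 0\<close> \<open>h2' \<noteq> 0\<close> by (auto simp: s_def)
  \<comment> \<open>Subtracting the multiple that matches the last entry leaves a pair in the same
    kernel.\<close>
  have "(h0' - s * h0) * q0 + (h1' - s * h1) * q1 =
      (h0' * q0 + h1' * q1 + h2' * q2) - s * (h0 * q0 + h1 * q1 + h2 * q2)"
    by (simp add: s(2) algebra_simps)
  then have "(h0' - s * h0) * q0 + (h1' - s * h1) * q1 = 0"
    by (simp only: h(1) h'(1) mult_zero_right diff_zero)
  moreover have "m * ((h0' - s * h0) * q1 + (h1' - s * h1) * q2) =
      (m * (h0' * q1 + h1' * q2) + t * h2') - s * (m * (h0 * q1 + h1 * q2) + t * h2)"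
    by (simp add: s(2) algebra_simps)
  then have "m * ((h0' - s * h0) * q1 + (h1' - s * h1) * q2) = 0"
    by (simp only: h(2) h'(2) mult_zero_right diff_zero)
  ultimately have "h0' = s * h0 \<and> h1' = s * h1"
    using key[of "h0' - s * h0" "h1' - s * h1"] False by simp
  then show ?thesis using s by blast
qed

text \<open>For a fixed operator the condition on \<open>(m, t)\<close> is one linear equation,
  nontrivial because the catalecticant is invertible. Its solutions form a line, so
  \<open>omega\<close> is single-valued.\<close>

lemma killed_cubic_unique:
  fixes q0 q1 q2 m t :: "'k::field"
  assumes disc: "q0 * q2 \<noteq> q1\<^sup>2"
    and h: "h0 * q0 + h1 * q1 + h2 * q2 = 0" "\<not> (h0 = 0 \<and> h1 = 0 \<and> h2 = 0)"
    and m: "m * (h0 * q1 + h1 * q2) + t * h2 = 0" "\<not> (m = 0 \<and> t = 0)"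
    and m': "m' * (h0 * q1 + h1 * q2) + t' * h2 = 0" "\<not> (m' = 0 \<and> t' = 0)"
  shows "\<exists>s. s \<noteq> 0 \<and> m' = s * m \<and> t' = s * t"
proof (cases "h2 = 0")
  case True
  have "h0 * q1 + h1 * q2 \<noteq> 0"
    using disc_kernel_trivial[OF disc, of h0 h1] h True by auto
  then have "m = 0" "m' = 0" using m(1) m'(1) True by auto
  then show ?thesis using m(2) m'(2) by (auto intro!: exI[of _ "t' / t"])
next
  case False
  have t: "t = - m * (h0 * q1 + h1 * q2) / h2" "t' = - m' * (h0 * q1 + h1 * q2) / h2"
    using m(1) m'(1) False by (simp_all add: field_simps eq_neg_iff_add_eq_0)
  then have "m \<noteq> 0" "m' \<noteq> 0" using m(2) m'(2) by auto
  then show ?thesis unfolding t by (auto intro!: exI[of _ "m' / m"])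
qed

section \<open>The map omega in coordinates\<close>

context apolar_frame
begin

lemma op_kills_cub_iff:
  assumes "h0 * q0 + h1 * q1 + h2 * q2 = 0"
  shows "apolar (op h0 h1 h2) (cub q0 q1 q2 m t) = 0 \<longleftrightarrow> m * (h0 * q1 + h1 * q2) + t * h2 = 0"
proof
  assume "apolar (op h0 h1 h2) (cub q0 q1 q2 m t) = 0"
  then have "6 * (m * (h0 * q1 + h1 * q2) + t * h2) = 0"
    unfolding apolar_op_cub by (rule linear_form_eq_0(2))
  then show "m * (h0 * q1 + h1 * q2) + t * h2 = 0"
    by (simp del: distrib_left_numeral)
qed (simp add: apolar_op_cub mult.assoc assms)

text \<open>Evaluates the definite description in \<open>omega_def\<close> from one nonzero cubic;
  \<open>killed_cubic_unique\<close> rules out any other line.\<close>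

lemma omega_eqI:
  assumes disc: "q0 * q2 \<noteq> q1\<^sup>2"
    and P: "P \<in> qproj a (qperp a 2 (quad q0 q1 q2))"
    and F: "F \<in> Lspace a b (quad q0 q1 q2)" "F \<noteq> 0" "\<forall>X\<in>P. qapolar X F = 0"
  shows "omega a b (quad q0 q1 q2) P = sym.span {F}"
proof -
  have q: "\<not> (q0 = 0 \<and> q1 = 0 \<and> q2 = 0)" using disc by auto
  obtain h0 h1 h2 where h: "P = qline a (op h0 h1 h2)" "h0 * q0 + h1 * q1 + h2 * q2 = 0"
      "\<not> (h0 = 0 \<and> h1 = 0 \<and> h2 = 0)"
    using P by (auto simp: qproj_qperp_quad)
  have kill: "(\<forall>X\<in>P. qapolar X (cub q0 q1 q2 m t) = 0) \<longleftrightarrow> m * (h0 * q1 + h1 * q2) + t * h2 = 0" for m t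
    using cub_kercomp[of q0 q1 q2 m t] unfolding h(1)
    by (simp add: kercomp_def qapolar_qline_eq_0_iff op_kills_cub_iff[OF h(2)])
  obtain m t where mt: "F = cub q0 q1 q2 m t" "\<not> (m = 0 \<and> t = 0)"
      "m * (h0 * q1 + h1 * q2) + t * h2 = 0"
    using F kill cub_eq_0_iff[OF q] by (metis Lspace_quad)
  show ?thesis
    unfolding omega_def
  proof (rule the_equality)
    have "s * m * (h0 * q1 + h1 * q2) + s * t * h2 = 0" for s
    proof -
      have "s * m * (h0 * q1 + h1 * q2) + s * t * h2 = s * (m * (h0 * q1 + h1 * q2) + t * h2)"
        by (simp add: algebra_simps)
      also have "\<dots> = 0" by (simp only: mt(3) mult_zero_right)
      finally show ?thesis .
    qed
    then have *: "\<forall>X\<in>P. qapolar X (const s * F) = 0" for s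
      unfolding mt(1) cub_scale[symmetric] kill .
    have "sym.span {F} \<in> proj (Lspace a b (quad q0 q1 q2))"
      unfolding proj_def using F(1,2) by blast
    moreover have "\<forall>X\<in>P. \<forall>F\<in>sym.span {F}. qapolar X F = 0"
      unfolding span_singleton_const using * by blast
    ultimately show "sym.span {F} \<in> proj (Lspace a b (quad q0 q1 q2)) \<and>
        (\<forall>X\<in>P. \<forall>F\<in>sym.span {F}. qapolar X F = 0)" ..
  next
    fix Q assume Q: "Q \<in> proj (Lspace a b (quad q0 q1 q2)) \<and> (\<forall>X\<in>P. \<forall>F\<in>Q. qapolar X F = 0)"
    then obtain G where G: "Q = sym.span {G}" "G \<in> Lspace a b (quad q0 q1 q2)" "G \<noteq> 0"
      by (auto simp: proj_def)
    have "G \<in> Q" unfolding G(1) by (simp add: sym.span_base)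
    with Q have "\<forall>X\<in>P. qapolar X G = 0" by blast
    then obtain m' t' where mt': "G = cub q0 q1 q2 m' t'" "\<not> (m' = 0 \<and> t' = 0)"
        "m' * (h0 * q1 + h1 * q2) + t' * h2 = 0"
      using G kill cub_eq_0_iff[OF q] by (metis Lspace_quad)
    obtain s where "s \<noteq> 0" "m' = s * m" "t' = s * t"
      using killed_cubic_unique[OF disc h(2,3) mt(3,2) mt'(3,2)] by blast
    then show "Q = sym.span {F}"
      unfolding G(1) mt'(1) mt(1) by (simp add: cub_scale span_const_mult)
  qed
qed

text \<open>A homogeneous linear equation in the two unknowns \<open>m\<close> and \<open>t\<close>
  has a nonzero solution.\<close>

lemma omega_ex:
  assumes disc: "q0 * q2 \<noteq> q1\<^sup>2"
    and P: "P \<in> qproj a (qperp a 2 (quad q0 q1 q2))"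
  shows "\<exists>F\<in>Lspace a b (quad q0 q1 q2). F \<noteq> 0 \<and> (\<forall>X\<in>P. qapolar X F = 0)"
proof -
  have q: "\<not> (q0 = 0 \<and> q1 = 0 \<and> q2 = 0)" using disc by auto
  obtain h0 h1 h2 where h: "P = qline a (op h0 h1 h2)" "h0 * q0 + h1 * q1 + h2 * q2 = 0"
      "\<not> (h0 = 0 \<and> h1 = 0 \<and> h2 = 0)"
    using P by (auto simp: qproj_qperp_quad)
  have ex: "\<exists>m t. m * (h0 * q1 + h1 * q2) + t * h2 = 0 \<and> \<not> (m = 0 \<and> t = 0)"
  proof (cases "h2 = 0")
    case True
    then have "0 * (h0 * q1 + h1 * q2) + 1 * h2 = 0 \<and> \<not> (0 = (0 :: 'k) \<and> 1 = (0 :: 'k))" by simp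
    then show ?thesis by blast
  next
    case False
    then have "h2 * (h0 * q1 + h1 * q2) + - (h0 * q1 + h1 * q2) * h2 = 0 \<and>
        \<not> (h2 = 0 \<and> - (h0 * q1 + h1 * q2) = 0)"
      by (simp add: algebra_simps)
    then show ?thesis by blast
  qed
  then obtain m t where mt: "m * (h0 * q1 + h1 * q2) + t * h2 = 0" "\<not> (m = 0 \<and> t = 0)" by blast
  have "\<forall>X\<in>P. qapolar X (cub q0 q1 q2 m t) = 0"
    using cub_kercomp[of q0 q1 q2 m t] mt(1) unfolding h(1)
    by (simp add: kercomp_def qapolar_qline_eq_0_iff op_kills_cub_iff[OF h(2)])
  then show ?thesis
    using mt(2) cub_eq_0_iff[OF q] by (metis Lspace_quad)
qed

text \<open>Surjectivity of \<open>omega\<close>, which provides the preimage in the definition of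
  \<open>theta\<close>.\<close>

lemma omega_surj:
  assumes disc: "q0 * q2 \<noteq> q1\<^sup>2"
    and F: "F \<in> Lspace a b (quad q0 q1 q2)" "F \<noteq> 0"
  shows "\<exists>P\<in>qproj a (qperp a 2 (quad q0 q1 q2)). \<forall>X\<in>P. qapolar X F = 0"
proof -
  have q: "\<not> (q0 = 0 \<and> q1 = 0 \<and> q2 = 0)" using disc by auto
  obtain m t where mt: "F = cub q0 q1 q2 m t" "\<not> (m = 0 \<and> t = 0)"
    using F cub_eq_0_iff[OF q] by (metis Lspace_quad)
  obtain h0 h1 h2 where h: "h0 * q0 + h1 * q1 + h2 * q2 = 0" "m * (h0 * q1 + h1 * q2) + t * h2 = 0"
      "\<not> (h0 = 0 \<and> h1 = 0 \<and> h2 = 0)"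
    using killing_op_exists[OF disc mt(2)] by blast
  have "\<forall>X\<in>qline a (op h0 h1 h2). qapolar X F = 0"
    using cub_kercomp[of q0 q1 q2 m t] h(2) unfolding mt(1)
    by (simp add: kercomp_def qapolar_qline_eq_0_iff op_kills_cub_iff[OF h(1)])
  then show ?thesis
    using h by (intro bexI[of _ "qline a (op h0 h1 h2)"]) (auto simp: qproj_qperp_quad)
qed

text \<open>This justifies \<open>the_inv_into\<close> in \<open>theta_def\<close>. If the values
  agree, both operators annihilate the same nonzero cubic, and \<open>killing_op_unique\<close>
  makes them proportional.\<close>

lemma omega_inj:
  assumes disc: "q0 * q2 \<noteq> q1\<^sup>2"
  shows "inj_on (omega a b (quad q0 q1 q2)) (qproj a (qperp a 2 (quad q0 q1 q2)))"
proof (rule inj_onI)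
  have q: "\<not> (q0 = 0 \<and> q1 = 0 \<and> q2 = 0)" using disc by auto
  fix P P' assume P: "P \<in> qproj a (qperp a 2 (quad q0 q1 q2))"
    and P': "P' \<in> qproj a (qperp a 2 (quad q0 q1 q2))"
    and eq: "omega a b (quad q0 q1 q2) P = omega a b (quad q0 q1 q2) P'"
  obtain F where F: "F \<in> Lspace a b (quad q0 q1 q2)" "F \<noteq> 0" "\<forall>X\<in>P. qapolar X F = 0"
    using omega_ex[OF disc P] by blast
  obtain F' where F': "F' \<in> Lspace a b (quad q0 q1 q2)" "F' \<noteq> 0" "\<forall>X\<in>P'. qapolar X F' = 0"
    using omega_ex[OF disc P'] by blast
  have "sym.span {F} = sym.span {F'}"
    using eq omega_eqI[OF disc P F] omega_eqI[OF disc P' F'] by simp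
  moreover have "F \<in> sym.span {F}" by (simp add: sym.span_base)
  ultimately have "F \<in> sym.span {F'}" by simp
  then obtain r where r: "F = const r * F'" by (auto simp: span_singleton_const)
  obtain h0 h1 h2 where h: "P = qline a (op h0 h1 h2)" "h0 * q0 + h1 * q1 + h2 * q2 = 0"
      "\<not> (h0 = 0 \<and> h1 = 0 \<and> h2 = 0)"
    using P by (auto simp: qproj_qperp_quad)
  obtain h0' h1' h2' where h': "P' = qline a (op h0' h1' h2')" "h0' * q0 + h1' * q1 + h2' * q2 = 0"
      "\<not> (h0' = 0 \<and> h1' = 0 \<and> h2' = 0)"
    using P' by (auto simp: qproj_qperp_quad)
  obtain m t where mt: "F = cub q0 q1 q2 m t" "\<not> (m = 0 \<and> t = 0)"
    using F cub_eq_0_iff[OF q] by (metis Lspace_quad)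
  have aF: "apolar a F = 0" "apolar a F' = 0"
    using F(1) F'(1) by (simp_all add: Lspace_def kercomp_def)
  have "apolar (op h0 h1 h2) F = 0" using F(3) aF(1) by (simp add: h(1) qapolar_qline_eq_0_iff)
  then have 1: "m * (h0 * q1 + h1 * q2) + t * h2 = 0"
    unfolding mt(1) op_kills_cub_iff[OF h(2)] .
  have "apolar (op h0' h1' h2') F' = 0" using F'(3) aF(2) by (simp add: h'(1) qapolar_qline_eq_0_iff)
  then have "apolar (op h0' h1' h2') F = 0" by (simp add: r apolar_const_mult_right)
  then have 2: "m * (h0' * q1 + h1' * q2) + t * h2' = 0"
    unfolding mt(1) op_kills_cub_iff[OF h'(2)] .
  obtain s where "s \<noteq> 0" "h0' = s * h0" "h1' = s * h1" "h2' = s * h2"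
    using killing_op_unique[OF disc mt(2) h(2) 1 h(3) h'(2) 2 h'(3)] by blast
  then show "P = P'"
    unfolding h(1) h'(1) by (simp add: op_scale qline_const_mult)
qed

end

section \<open>The map theta over an algebraically closed field\<close>

locale closed_apolar_frame = apolar_frame a b c ya yb yc
  for a b c ya yb yc :: "('n::finite, 'k::{alg_closed_field, field_char_0}) sym"
begin

text \<open>If the discriminant vanishes, a square root of an outer coefficient exhibits the quadric
  as a square.\<close>

lemma disc_nonzero:
  assumes nsq: "\<not> (\<exists>l\<in>homog 1. quad q0 q1 q2 = l ^ 2)"
  shows "q0 * q2 \<noteq> q1\<^sup>2"
proof
  assume e: "q0 * q2 = q1\<^sup>2"
  have 1: "const s * yb + const t * yc \<in> homog 1" for s t
    using deg by (intro homog_add homog_const_mult)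
  have 2: "(const s * yb + const t * yc) ^ 2 = quad (s ^ 2) (s * t) (t ^ 2)" for s t
    by (simp add: quad_def power2_eq_square const_mult algebra_simps)
  show False
  proof (cases "q0 = 0")
    case True
    then have "q1 = 0" using e by simp
    obtain t where "t ^ 2 = q2" using nth_root_exists[of 2] by auto
    then have "quad q0 q1 q2 = (const 0 * yb + const t * yc) ^ 2"
      unfolding 2 using True \<open>q1 = 0\<close> by simp
    then show False using nsq 1 by blast
  next
    case False
    obtain s where s: "s ^ 2 = q0" using nth_root_exists[of 2] by auto
    then have "s \<noteq> 0" using False by auto
    have "quad q0 q1 q2 = (const s * yb + const (q1 / s) * yc) ^ 2"
      unfolding 2 using s False \<open>s \<noteq> 0\<close> by (simp add: power_divide flip: e)
    then show False using nsq 1 by blast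
  qed
qed

text \<open>Unfolds the composite: \<open>F\<close> spans the value of \<open>omega\<close> at
  \<open>P\<close>, \<open>const l * g - F\<close> is its image under \<open>psi\<close>, and
  \<open>theta\<close> takes the preimage of the span of the latter under the second
  \<open>omega\<close>.\<close>

lemma theta_props:
  assumes g: "g \<in> homog 3" "apolar (a * b) g = 0"
    and qa: "\<not> (\<exists>l\<in>homog 1. apolar b g = l ^ 2)"
    and qb: "\<not> (\<exists>l\<in>homog 1. apolar a g = l ^ 2)"
    and P: "P \<in> qproj a (qperp a 2 (apolar b g))"
  shows "theta g a b P \<in> qproj b (qperp b 2 (apolar a g)) \<and>
    (\<exists>F l. F \<in> kercomp a 3 \<and> F \<noteq> 0 \<and> apolar b F = const l * apolar b g
      \<and> (\<forall>X\<in>P. qapolar X F = 0) \<and> (\<forall>X\<in>theta g a b P. qapolar X (const l * g - F) = 0))"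
proof -
  interpret ba: closed_apolar_frame b a c yb ya yc
    by (rule closed_apolar_frame.intro) (rule swap_ab)
  have "apolar b g \<in> kercomp a 2" "apolar a g \<in> kercomp b 2"
    using homog_apolar[of b 1 g 2] homog_apolar[of a 1 g 2] deg g
    by (simp_all add: kercomp_def apolar_mult apolar_commute[of b] numeral_2_eq_2 numeral_3_eq_3)
  note k = this
  obtain q0 q1 q2 where qq: "apolar b g = quad q0 q1 q2"
    by (rule quad_form[OF k(1)])
  obtain p0 p1 p2 where pp: "apolar a g = ba.quad p0 p1 p2"
    by (rule ba.quad_form[OF k(2)])
  have dq: "q0 * q2 \<noteq> q1\<^sup>2" using disc_nonzero qa unfolding qq by blast
  have dp: "p0 * p2 \<noteq> p1\<^sup>2" using ba.disc_nonzero qb unfolding pp by blast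
  have nz: "apolar b g \<noteq> 0" "apolar a g \<noteq> 0"
  proof -
    \<comment> \<open>Zero counts as a square, so \<open>qa\<close> and \<open>qb\<close> exclude
      it.\<close>
    have "(0 :: ('n, 'k) sym) = 0 ^ 2" by simp
    then show "apolar b g \<noteq> 0" "apolar a g \<noteq> 0" using qa qb homog_0[of 1] by metis+
  qed
  obtain F where F: "F \<in> Lspace a b (apolar b g)" "F \<noteq> 0" "\<forall>X\<in>P. qapolar X F = 0"
    using omega_ex[OF dq] P unfolding qq by blast
  obtain l where l: "F \<in> kercomp a 3" "apolar b F = const l * apolar b g"
    using F(1) by (auto simp: Lspace_def span_singleton_const)
  have om: "omega a b (apolar b g) P = sym.span {F}"
    unfolding qq by (rule omega_eqI[OF dq]) (use P F in \<open>simp_all add: qq\<close>)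
  let ?G = "const l * g - F"
  have psi: "psi g b (const s * F) = const s * ?G" for s
  proof -
    \<comment> \<open>The scalar is unique because the derivative of \<open>g\<close> along
      \<open>b\<close> is nonzero.\<close>
    have "(THE k. apolar b (const s * F) = scale k (apolar b g)) = s * l"
    proof (rule the_equality)
      show "apolar b (const s * F) = scale (s * l) (apolar b g)"
        by (simp add: scale_def apolar_const_mult_right l const_mult mult.assoc)
      fix k assume "apolar b (const s * F) = scale k (apolar b g)"
      then have "const (k - s * l) * apolar b g = 0"
        by (simp add: scale_def apolar_const_mult_right l const_mult mult.assoc single_diff left_diff_distrib)
      then show "k = s * l" using nz(1) const_mult_eq_0[of "k - s * l"] by auto
    qed
    then show ?thesis
      by (simp add: psi_def scale_def const_mult algebra_simps)
  qed
  have G: "?G \<in> Lspace b a (apolar a g)"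
  proof -
    have "apolar a ?G = const l * apolar a g"
      using l by (simp add: apolar_diff_right apolar_const_mult_right kercomp_def)
    then show ?thesis
      using l g unfolding Lspace_def span_singleton_const
      by (auto simp: kercomp_def homog_diff homog_const_mult apolar_diff_right apolar_const_mult_right)
  qed
  \<comment> \<open>If \<open>psi\<close> sent \<open>F\<close> to zero, differentiating along
    \<open>a\<close> would give \<open>l = 0\<close> and hence \<open>F = 0\<close>.\<close>
  have G0: "?G \<noteq> 0"
  proof
    assume *: "?G = 0"
    then have "apolar a (const l * g) = apolar a F" by simp
    then have "const l * apolar a g = 0"
      using l by (simp add: kercomp_def apolar_const_mult_right)
    then have "l = 0" using nz(2) const_mult_eq_0[of l] by blast
    then show False using * F(2) by simp
  qed
  have im: "psi g b ` sym.span {F} = sym.span {?G}"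
    unfolding span_singleton_const image_image psi ..
  \<comment> \<open>Surjectivity provides a preimage; injectivity then identifies it with the value
    of \<open>the_inv_into\<close>.\<close>
  obtain P' where P': "P' \<in> qproj b (qperp b 2 (apolar a g))" "\<forall>X\<in>P'. qapolar X ?G = 0"
    using ba.omega_surj[OF dp] G G0 unfolding pp by blast
  have om': "omega b a (apolar a g) P' = sym.span {?G}"
    unfolding pp by (rule ba.omega_eqI[OF dp]) (use P' G G0 in \<open>simp_all add: pp\<close>)
  have "inj_on (omega b a (apolar a g)) (qproj b (qperp b 2 (apolar a g)))"
    unfolding pp by (rule ba.omega_inj[OF dp])
  then have th: "theta g a b P = P'"
    unfolding theta_def comp_def om im using om' P'(1) by (rule the_inv_into_f_eq)
  have "F \<in> kercomp a 3 \<and> F \<noteq> 0 \<and> apolar b F = const l * apolar b g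
      \<and> (\<forall>X\<in>P. qapolar X F = 0) \<and> (\<forall>X\<in>theta g a b P. qapolar X ?G = 0)"
    unfolding th using F(2,3) l P'(2) by (intro conjI)
  then show ?thesis unfolding th using P'(1) by blast
qed

end

section \<open>Roots and quartics\<close>

context apolar_frame
begin

lemma quad_square: "(const s * yb + const t * yc) ^ 2 = quad (s ^ 2) (s * t) (t ^ 2)"
  by (simp add: quad_def power2_eq_square const_mult algebra_simps)

text \<open>Scaling the operator by \<open>k\<close> and the vector by \<open>r\<close> scales the
  evaluation by \<open>k * r ^ 2\<close>, so being a root depends only on the two lines. The 2 in
  \<open>apolar_op_quad\<close> cancels \<open>fact 2\<close> in \<open>qeval\<close>.\<close>

lemma qroots_qline_iff:
  assumes u: "u = const s * yb + const t * yc" "u \<noteq> 0"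
  shows "sym.span {u} \<in> qroots a (qline a (op h0 h1 h2)) \<longleftrightarrow> h0 * s ^ 2 + h1 * (s * t) + h2 * t ^ 2 = 0"
proof -
  let ?e = "h0 * s ^ 2 + h1 * (s * t) + h2 * t ^ 2"
  have ku: "u \<in> kercomp a 1"
    unfolding u(1) by (intro kercomp_add kercomp_const_mult kercomp_y)
  have ev: "qeval 2 (qclass a (const k * op h0 h1 h2)) (const r * u) = k * r ^ 2 * ?e" for k r
  proof -
    have "(const r * u) ^ 2 = const (r ^ 2) * quad (s ^ 2) (s * t) (t ^ 2)"
      unfolding power_mult_distrib u(1) quad_square by (simp add: power2_eq_square const_mult)
    then have "apolar (const k * op h0 h1 h2) ((const r * u) ^ 2) = const (k * r ^ 2 * (2 * ?e))"
      by (simp only: apolar_mult apolar_const apolar_const_mult_right apolar_op_quad const_mult mult.assoc mult.left_commute)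
    moreover have "apolar a ((const r * u) ^ 2) = 0"
      using kercomp_power[OF deg(1) kercomp_const_mult[OF ku], of r 2] by (simp add: kercomp_def)
    ultimately show ?thesis
      by (simp only: qeval_def qpairing_def qapolar_qclass lookup_single_eq fact_2) simp
  qed
  have "sym.span {u} \<in> proj (kercomp a 1)"
    unfolding proj_def using ku u(2) by blast
  then have "sym.span {u} \<in> qroots a (qline a (op h0 h1 h2)) \<longleftrightarrow>
      (\<forall>k r. k * r ^ 2 * ?e = 0)"
    unfolding qroots_def qline_def span_singleton_const by (auto simp: ev)
  also have "\<dots> \<longleftrightarrow> ?e = 0"
  proof
    assume "\<forall>k r. k * r ^ 2 * ?e = 0"
    then have "1 * 1 ^ 2 * ?e = 0" by blast
    then show "?e = 0" by simp
  qed simp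
  finally show ?thesis .
qed

lemma y_nonzero: "yb \<noteq> 0" "yc \<noteq> 0"
  using dual(5) dual(9) by force+

text \<open>The points spanned by \<open>yb\<close> and \<open>yc\<close> are two of the excluded
  points v_j; that they are no roots makes both outer coefficients of the operator nonzero.\<close>

lemma qroots_yb_yc:
  "sym.span {yb} \<in> qroots a (qline a (op h0 h1 h2)) \<longleftrightarrow> h0 = 0"
  "sym.span {yc} \<in> qroots a (qline a (op h0 h1 h2)) \<longleftrightarrow> h2 = 0"
  using qroots_qline_iff[of yb 1 0] qroots_qline_iff[of yc 0 1] y_nonzero by simp_all

text \<open>With both outer coefficients nonzero, a root has two nonzero coordinates, and the first
  can be scaled to 1.\<close>

lemma qroots_form:
  assumes R: "R \<in> qroots a (qline a (op h0 h1 h2))" and h: "h0 \<noteq> 0" "h2 \<noteq> 0"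
  shows "\<exists>m. m \<noteq> 0 \<and> R = sym.span {yb + const m * yc} \<and> h0 + h1 * m + h2 * m ^ 2 = 0"
proof -
  obtain u where u: "R = sym.span {u}" "u \<in> kercomp a 1" "u \<noteq> 0"
    using R by (auto simp: qroots_def proj_def)
  obtain s t where st: "u = const s * yb + const t * yc" by (rule linear_form[OF u(2)])
  have e: "h0 * s ^ 2 + h1 * (s * t) + h2 * t ^ 2 = 0"
    using R qroots_qline_iff[OF st u(3)] u(1) by simp
  have "s \<noteq> 0" using e h st u(3) by auto
  then have "t \<noteq> 0" using e h by auto
  have "u = const s * (yb + const (t / s) * yc)"
    using \<open>s \<noteq> 0\<close> unfolding st by (simp add: distrib_left flip: mult.assoc const_mult)
  then have "R = sym.span {yb + const (t / s) * yc}"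
    using u(1) span_const_mult[OF \<open>s \<noteq> 0\<close>] by metis
  moreover have "h0 + h1 * (t / s) + h2 * (t / s) ^ 2 = 0"
  proof -
    have "s ^ 2 * (h0 + h1 * (t / s) + h2 * (t / s) ^ 2) = h0 * s ^ 2 + h1 * (s * t) + h2 * t ^ 2"
      using \<open>s \<noteq> 0\<close> by (simp add: field_simps power2_eq_square)
    then show ?thesis using e \<open>s \<noteq> 0\<close> by simp
  qed
  ultimately show ?thesis using \<open>s \<noteq> 0\<close> \<open>t \<noteq> 0\<close> by (intro exI[of _ "t / s"]) simp
qed

text \<open>Such a \<open>D\<close> is a multiple of the cube of \<open>yc\<close>, and if it were
  nonzero, \<open>yc\<close> would be a root of \<open>P\<close>. Applied to differences, this
  identifies cubics with equal derivatives along \<open>b\<close>.\<close>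

lemma eq_0_if_killed:
  assumes D: "D \<in> kercomp a 3" "apolar b D = 0"
    and P: "P \<in> qproj a (qperp a 2 q)" "q \<in> kercomp a 2"
    and kill: "\<forall>X\<in>P. qapolar X D = 0" and yc: "sym.span {yc} \<notin> qroots a P"
  shows "D = 0"
proof -
  obtain q0 q1 q2 where q: "q = quad q0 q1 q2" by (rule quad_form[OF P(2)])
  obtain h0 h1 h2 where h: "P = qline a (op h0 h1 h2)" "h0 * q0 + h1 * q1 + h2 * q2 = 0"
    using P(1) unfolding q qproj_qperp_quad by blast
  have "h2 \<noteq> 0" using yc unfolding h(1) qroots_yb_yc .
  obtain t where "D = const t * yc ^ 3" using yc_power[OF D] by blast
  then have t: "D = cub q0 q1 q2 0 t" by (simp add: cub_def)
  have "apolar (op h0 h1 h2) D = 0"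
    using kill D(1) unfolding h(1) by (simp add: qapolar_qline_eq_0_iff kercomp_def)
  then have "t * h2 = 0" unfolding t op_kills_cub_iff[OF h(2)] by simp
  then show ?thesis using \<open>h2 \<noteq> 0\<close> by (simp add: t cub_def)
qed

end

section \<open>The quartic attached to two roots\<close>

context closed_apolar_frame
begin

text \<open>The scalars come from writing \<open>q\<close> in the squares of the two roots and
  undoing two differentiations. The last conjunct holds for every \<open>z\<close> because operators
  commute.\<close>

lemma qroots_quartic:
  assumes q: "q \<in> kercomp a 2" "\<not> (\<exists>l\<in>homog 1. q = l ^ 2)"
    and P: "P \<in> qproj a (qperp a 2 q)"
    and two: "card (qroots a P) = 2"
    and y: "sym.span {yb} \<notin> qroots a P" "sym.span {yc} \<notin> qroots a P"
  shows "\<exists>l g. (\<forall>R\<in>qroots a P. l R \<in> homog 1 \<and> l R \<noteq> 0 \<and> sym.span {l R} = R)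
    \<and> g = (\<Sum>R\<in>qroots a P. l R ^ 4) \<and> g \<in> kercomp a 4 \<and> apolar b (apolar c g) = q
    \<and> (\<forall>z. \<forall>X\<in>P. qapolar X (apolar z g) = 0)"
proof -
  obtain q0 q1 q2 where qq: "q = quad q0 q1 q2" by (rule quad_form[OF q(1)])
  have disc: "q0 * q2 \<noteq> q1\<^sup>2" using disc_nonzero q(2) unfolding qq by blast
  obtain h0 h1 h2 where h: "P = qline a (op h0 h1 h2)" "h0 * q0 + h1 * q1 + h2 * q2 = 0"
    using P unfolding qq qproj_qperp_quad by blast
  have h0: "h0 \<noteq> 0" and h2: "h2 \<noteq> 0" using y unfolding h(1) qroots_yb_yc by simp_all
  obtain R1 R2 where R: "qroots a P = {R1, R2}" "R1 \<noteq> R2"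
    using two by (auto simp: card_2_iff)
  define U where "U m = yb + const m * yc" for m
  have form: "\<exists>m. m \<noteq> 0 \<and> R = sym.span {U m} \<and> h0 + h1 * m + h2 * m ^ 2 = 0"
    if "R \<in> qroots a P" for R
    unfolding U_def by (rule qroots_form[OF _ h0 h2]) (use that h(1) in simp)
  obtain m1 where m1: "m1 \<noteq> 0" "R1 = sym.span {U m1}" "h0 + h1 * m1 + h2 * m1 ^ 2 = 0"
    using form[of R1] R(1) by blast
  obtain m2 where m2: "m2 \<noteq> 0" "R2 = sym.span {U m2}" "h0 + h1 * m2 + h2 * m2 ^ 2 = 0"
    using form[of R2] R(1) by blast
  have "m1 \<noteq> m2" using R(2) m1(2) m2(2) by blast
  have "(m1 - m2) * (h1 + h2 * (m1 + m2)) =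
      (h0 + h1 * m1 + h2 * m1 ^ 2) - (h0 + h1 * m2 + h2 * m2 ^ 2)"
    by (simp add: algebra_simps power2_eq_square)
  also have "\<dots> = 0" by (simp only: m1(3) m2(3) diff_zero)
  finally have "h1 + h2 * (m1 + m2) = 0" using \<open>m1 \<noteq> m2\<close> by simp
  \<comment> \<open>Vieta's formulas for the two affine roots.\<close>
  then have h1: "h1 = - (h2 * (m1 + m2))" by (simp only: eq_neg_iff_add_eq_0)
  have h0': "h0 = h2 * (m1 * m2)"
    using m1(3) unfolding h1 by (simp add: algebra_simps power2_eq_square)
  \<comment> \<open>Orthogonality to \<open>q\<close> becomes a recurrence that determines the third
    coefficient from the first two.\<close>
  have "h2 * (m1 * m2 * q0 - (m1 + m2) * q1 + q2) = h0 * q0 + h1 * q1 + h2 * q2"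
    unfolding h1 h0' by (simp add: algebra_simps)
  then have "m1 * m2 * q0 - (m1 + m2) * q1 + q2 = 0" using h(2) h2 by simp
  then have q2: "q2 = (m1 + m2) * q1 - m1 * m2 * q0" by (simp add: algebra_simps)
  \<comment> \<open>Cramer's rule for the first two equations in \<open>AB\<close>; the recurrence
    then gives the third.\<close>
  define A B where "A = (q1 - m2 * q0) / (m1 - m2)" and "B = (m1 * q0 - q1) / (m1 - m2)"
  have "m1 - m2 \<noteq> 0" using \<open>m1 \<noteq> m2\<close> by simp
  have AB: "A + B = q0" "A * m1 + B * m2 = q1" "A * m1 ^ 2 + B * m2 ^ 2 = q2"
  proof -
    have a: "A * (m1 - m2) = q1 - m2 * q0" and b: "B * (m1 - m2) = m1 * q0 - q1"
      using \<open>m1 - m2 \<noteq> 0\<close> by (simp_all add: A_def B_def)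
    have e: "(A * s + B * t) * (m1 - m2) = s * (A * (m1 - m2)) + t * (B * (m1 - m2))" for s t
      by (simp add: algebra_simps)
    have "(A * 1 + B * 1) * (m1 - m2) = q0 * (m1 - m2)"
      "(A * m1 + B * m2) * (m1 - m2) = q1 * (m1 - m2)"
      "(A * m1 ^ 2 + B * m2 ^ 2) * (m1 - m2) = q2 * (m1 - m2)"
      unfolding e a b q2 by (simp_all add: algebra_simps power2_eq_square)
    then show "A + B = q0" "A * m1 + B * m2 = q1" "A * m1 ^ 2 + B * m2 ^ 2 = q2"
      using \<open>m1 - m2 \<noteq> 0\<close> by simp_all
  qed
  \<comment> \<open>The discriminant equals \<open>A * B * (m1 - m2) ^ 2\<close>.\<close>
  have A: "A \<noteq> 0" and B: "B \<noteq> 0"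
    using disc unfolding AB[symmetric] by (auto simp: power2_eq_square)
  \<comment> \<open>Applying \<open>b\<close> and \<open>c\<close> to the fourth power of
    \<open>U m\<close> gives \<open>12 * m\<close> times its square; hence the denominators.\<close>
  obtain s1 where s1: "s1 ^ 4 = A / (12 * m1)" using nth_root_exists[of 4] by auto
  obtain s2 where s2: "s2 ^ 4 = B / (12 * m2)" using nth_root_exists[of 4] by auto
  have s0: "s1 \<noteq> 0" "s2 \<noteq> 0" using s1 s2 A B m1(1) m2(1) by auto
  define l where "l R = (if R = R1 then const s1 * U m1 else const s2 * U m2)" for R
  define g where "g = (const s1 * U m1) ^ 4 + (const s2 * U m2) ^ 4"
  have U: "U m \<in> kercomp a 1" for m
    unfolding U_def by (intro kercomp_add kercomp_const_mult kercomp_y)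
  have U0: "U m \<noteq> 0" for m
  proof
    have "apolar b (U m) = 1" by (simp add: U_def frame_derivation)
    moreover assume "U m = 0"
    ultimately show False by simp
  qed
  have lR: "l R \<in> homog 1 \<and> l R \<noteq> 0 \<and> sym.span {l R} = R" if "R \<in> qroots a P" for R
    using that R(1) m1(2) m2(2) U U0 s0
    by (auto simp: l_def kercomp_def homog_const_mult span_const_mult dest: const_mult_eq_0)
  have gsum: "g = (\<Sum>R\<in>qroots a P. l R ^ 4)"
    unfolding R(1) g_def l_def using R(2) by simp
  have gk: "g \<in> kercomp a 4"
    using kercomp_power[OF deg(1) kercomp_const_mult[OF U], of _ _ 4] unfolding g_def
    by (auto intro!: kercomp_add)
  have dU: "apolar b (U m) = const 1" "apolar c (U m) = const m" for m
    by (simp_all add: U_def frame_derivation)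
  have dd: "apolar z (apolar w (U m ^ 4)) = const (12 * j * k) * U m ^ 2"
    if "z \<in> homog 1" "w \<in> homog 1" "apolar z (U m) = const j" "apolar w (U m) = const k" for z w m j k
  proof -
    have "apolar w (U m ^ 4) = const (4 * k) * U m ^ 3"
      using derivation_power[OF that(2), of "U m" 3] that(4) by (simp add: const_mult mult_ac)
    moreover have "apolar z (U m ^ 3) = const (3 * j) * U m ^ 2"
      using derivation_power[OF that(1), of "U m" 2] that(3) by (simp add: const_mult mult_ac)
    ultimately show ?thesis
      by (simp add: apolar_const_mult_right apolar_numeral_mult_right const_mult mult_ac)
  qed
  note dd = dd[OF deg(2) deg(2) dU(1) dU(1)] dd[OF deg(2) deg(3) dU] dd[OF deg(3) deg(3) dU(2) dU(2)]
  have U2: "U m ^ 2 = quad 1 m (m ^ 2)" for m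
    using quad_square[of 1 m] by (simp add: U_def)
  have c4: "(const s * u) ^ 4 = const (s ^ 4) * u ^ 4" for s u
    by (simp add: power_mult_distrib const_mult eval_nat_numeral)
  have bc: "apolar b (apolar c g) = q"
  proof -
    have 1: "apolar b (apolar c (U m ^ 4)) = 12 * const m * quad 1 m (m ^ 2)" for m
      by (simp add: dd U2 const_mult)
    have "apolar b (apolar c g) = const (s1 ^ 4) * (12 * const m1 * quad 1 m1 (m1 ^ 2)) +
        const (s2 ^ 4) * (12 * const m2 * quad 1 m2 (m2 ^ 2))"
      unfolding g_def c4 by (simp add: apolar_add_right apolar_const_mult_right 1)
    also have "\<dots> = const (s1 ^ 4 * 12 * m1) * quad 1 m1 (m1 ^ 2) + const (s2 ^ 4 * 12 * m2) * quad 1 m2 (m2 ^ 2)"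
      by (simp add: const_mult mult.assoc)
    also have "s1 ^ 4 * 12 * m1 = A" using m1(1) by (simp add: s1)
    also have "s2 ^ 4 * 12 * m2 = B" using m2(1) by (simp add: s2)
    also have "const A * quad 1 m1 (m1 ^ 2) + const B * quad 1 m2 (m2 ^ 2) =
        quad (A + B) (A * m1 + B * m2) (A * m1 ^ 2 + B * m2 ^ 2)"
      by (simp add: quad_def single_add const_mult algebra_simps)
    finally show ?thesis unfolding AB qq .
  qed
  \<comment> \<open>The operator contributes its own polynomial at \<open>m\<close> as a factor,
    which vanishes at both roots.\<close>
  have "apolar (op h0 h1 h2) (U m ^ 4) = 12 * const (h0 + h1 * m + h2 * m ^ 2) * U m ^ 2" for m
    by (simp add: op_def apolar_add_left apolar_mult power2_eq_square[of b] power2_eq_square[of c] dd)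
      (simp add: single_add const_mult power2_eq_square[of m] algebra_simps)
  then have "apolar (op h0 h1 h2) g = 0"
    unfolding g_def c4 by (simp add: apolar_add_right apolar_const_mult_right m1(3) m2(3))
  then have "apolar (op h0 h1 h2) (apolar z g) = 0" for z
    by (simp add: apolar_commute[of _ z])
  moreover have "apolar a (apolar z g) = 0" for z
    using gk by (simp add: apolar_commute[of _ z] kercomp_def)
  ultimately have kill: "\<forall>z. \<forall>X\<in>P. qapolar X (apolar z g) = 0"
    unfolding h(1) by (simp add: qapolar_qline_eq_0_iff)
  show ?thesis
    using lR gsum gk bc kill by (intro exI[of _ l] exI[of _ g]) simp
qed

end

section \<open>Dual bases\<close>

lemma UNIV_three: "(UNIV :: 3 set) = {i, i + 1, i + 2}"
proof (rule card_seteq[symmetric])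
  have "i + 1 \<noteq> i" "i + 2 \<noteq> i" "i + 1 \<noteq> i + 2" by simp_all
  then show "card (UNIV :: 3 set) \<le> card {i, i + 1, i + 2}" by simp
qed auto

lemma sum_three: "(\<Sum>k\<in>UNIV. g k) = g i + (g (i + 1) + g (i + 2))" for i :: 3
  unfolding UNIV_three[of i] by simp

lemma prod_three: "(\<Prod>k\<in>UNIV. g k) = g i * (g (i + 1) * g (i + 2))" for i :: 3
  unfolding UNIV_three[of i] by simp

lemma three_cycle: "i + 1 + 2 = i" "i + 2 + 1 = i" "i + 1 + 1 = i + 2" "i + 2 + 2 = i + 1" for i :: 3
  by (simp_all add: add.assoc)

lemma independent_coeff_eq_0:
  assumes "inj x" "sym.independent (range x)" "(\<Sum>j\<in>UNIV. const (s j) * x j) = 0"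
  shows "s (j :: 'i :: finite) = 0"
proof -
  have "(\<Sum>v\<in>range x. scale (s (inv x v)) v) = (\<Sum>j\<in>UNIV. const (s j) * x j)"
    using assms(1) by (simp add: sum.reindex scale_def)
  then have "s (inv x (x j)) = 0"
    using assms by (intro sym.independentD[of "range x" "range x" "\<lambda>v. s (inv x v)" "x j"]) auto
  then show ?thesis using assms(1) by simp
qed

text \<open>A form outside the span would enlarge the family to \<open>CARD('n) + 1\<close>
  independent vectors inside the span of \<open>CARD('n)\<close> indeterminates.\<close>

lemma homog_1_subset_span:
  fixes x :: "'i :: finite \<Rightarrow> ('n :: finite, 'k :: field) sym"
  assumes card: "CARD('n) = CARD('i)" and x: "\<And>i. x i \<in> homog 1"
    and ind: "inj x" "sym.independent (range x)"
  shows "homog 1 \<subseteq> sym.span (range x)"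
proof
  fix p :: "('n, 'k) sym" assume p: "p \<in> homog 1"
  have sub: "r \<in> sym.span (range indet)" if r: "r \<in> homog 1" for r :: "('n, 'k) sym"
  proof -
    have "(\<Sum>i\<in>UNIV. scale (Poly_Mapping.lookup r (Poly_Mapping.single i 1)) (indet i))
        \<in> sym.span (range indet)"
      by (intro sym.span_sum sym.span_scale sym.span_base rangeI)
    then show ?thesis unfolding scale_def homog_1_eq_sum[OF r, symmetric] .
  qed
  show "p \<in> sym.span (range x)"
  proof (rule ccontr)
    assume n: "p \<notin> sym.span (range x)"
    then have 1: "sym.independent (insert p (range x))"
      using ind(2) by (rule sym.independent_insertI)
    have 2: "insert p (range x) \<subseteq> sym.span (range indet)"
      using sub[OF p] sub[OF x] by blast
    have "card (insert p (range x)) \<le> card (range (indet :: 'n \<Rightarrow> ('n, 'k) sym))"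
      using sym.independent_span_bound[OF _ 1 2] by simp
    also have "\<dots> \<le> CARD('n)" by (rule card_image_le) simp
    moreover have "card (insert p (range x)) = Suc (CARD('i))"
      using n sym.span_base[of p "range x"] ind(1) by (subst card_insert_disjoint) (auto simp: card_image)
    ultimately show False using card by simp
  qed
qed

text \<open>The dual basis has the transposed coefficients of the indeterminates in terms of
  \<open>x\<close>. Then the sum of the tensors of \<open>y i\<close> with \<open>x i\<close> is the
  one for the indeterminates, which turns \<open>euler\<close> into both Euler identities.\<close>

lemma dual_basis:
  fixes x :: "'i :: finite \<Rightarrow> ('n :: finite, 'k :: field) sym"
  assumes card: "CARD('n) = CARD('i)" and x: "\<And>i. x i \<in> homog 1"
    and ind: "inj x" "sym.independent (range x)"
  shows "\<exists>y. (\<forall>i. y i \<in> homog 1) \<and> (\<forall>i j. apolar (x i) (y j) = (if i = j then 1 else 0))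
    \<and> (\<forall>d. \<forall>f\<in>homog d. (\<Sum>i\<in>UNIV. y i * apolar (x i) f) = of_nat d * f)
    \<and> (\<forall>d. \<forall>f\<in>homog d. (\<Sum>i\<in>UNIV. x i * apolar (y i) f) = of_nat d * f)"
proof -
  have "\<exists>s. indet n = (\<Sum>j\<in>UNIV. const (s j) * x j)" for n
  proof -
    have "indet n \<in> sym.span (range x)"
      using homog_1_subset_span[OF card x ind] indet_homog by blast
    then obtain u where "indet n = (\<Sum>v\<in>range x. scale (u v) v)"
      by (auto simp: sym.span_finite)
    also have "\<dots> = (\<Sum>j\<in>UNIV. const (u (x j)) * x j)"
      using ind(1) by (simp add: sum.reindex scale_def)
    finally show ?thesis by (rule exI[of _ "\<lambda>j. u (x j)"])
  qed
  then obtain M where M: "indet n = (\<Sum>j\<in>UNIV. const (M n j) * x j)" for n by metis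
  define y where "y j = (\<Sum>n\<in>UNIV. const (M n j) * indet n)" for j
  have y: "y j \<in> homog 1" for j
    unfolding y_def by (intro homog_sum homog_const_mult indet_homog)
  define X where "X i n = Poly_Mapping.lookup (x i) (Poly_Mapping.single n 1)" for i n
  have X: "x i = (\<Sum>n\<in>UNIV. const (X i n) * indet n)" for i
    unfolding X_def by (rule homog_1_eq_sum[OF x])
  have delta: "apolar (indet m) (indet n) = (if m = n then 1 else 0 :: ('n, 'k) sym)" for m n
    by (auto simp: apolar_single falling_indet lookup_single when_def)
  have "apolar (x i) (indet n) = const (X i n)" for i n
    unfolding X[of i]
    by (simp add: apolar_sum_left apolar_mult delta if_distrib[of "\<lambda>s. _ * s"] cong: if_cong del: One_nat_def)
  then have Xy: "apolar (x i) (y j) = const (\<Sum>n\<in>UNIV. X i n * M n j)" for i j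
    unfolding y_def
    by (simp add: apolar_sum_right apolar_const_mult_right const_sum const_mult mult.commute del: One_nat_def)
  \<comment> \<open>Expanding \<open>x i\<close> in the indeterminates, and these in
    \<open>x\<close> again, shows by independence that the matrix product is the identity.\<close>
  have "(\<Sum>n\<in>UNIV. X i n * M n j) = (if i = j then 1 else 0)" for i j
  proof -
    have "x i = (\<Sum>n\<in>UNIV. const (X i n) * (\<Sum>j\<in>UNIV. const (M n j) * x j))"
      unfolding M[symmetric] by (rule X)
    also have "\<dots> = (\<Sum>j\<in>UNIV. const (\<Sum>n\<in>UNIV. X i n * M n j) * x j)"
      by (simp add: const_sum const_mult sum_distrib_left sum_distrib_right mult.assoc sum.swap[of _ "UNIV :: 'i set"])
    finally have "(\<Sum>j\<in>UNIV. const (\<Sum>n\<in>UNIV. X i n * M n j) * x j) = x i" ..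
    moreover have "(\<Sum>j\<in>UNIV. const (if i = j then 1 else 0) * x j) = x i"
      by (simp add: if_distrib[of const] if_distrib[of "\<lambda>s. s * _"] cong: if_cong)
    ultimately have "(\<Sum>j\<in>UNIV. const ((\<Sum>n\<in>UNIV. X i n * M n j) - (if i = j then 1 else 0)) * x j) = 0"
      by (simp add: single_diff left_diff_distrib sum_subtractf)
    from independent_coeff_eq_0[OF ind this, of j] show ?thesis by simp
  qed
  then have dual: "apolar (x i) (y j) = (if i = j then 1 else 0)" for i j
    unfolding Xy by simp
  have "(\<Sum>i\<in>UNIV. y i * apolar (x i) f) = of_nat d * f" if "f \<in> homog d" for f d
  proof -
    have "(\<Sum>i\<in>UNIV. y i * apolar (x i) f) = (\<Sum>n\<in>UNIV. indet n * apolar (\<Sum>i\<in>UNIV. const (M n i) * x i) f)"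
      unfolding y_def
      by (simp add: sum_distrib_left sum_distrib_right apolar_sum_left apolar_mult
          sum.swap[of _ "UNIV :: 'i set"] del: One_nat_def) (simp only: mult_ac)
    then show ?thesis unfolding M[symmetric] using euler[OF that] by simp
  qed
  moreover have "(\<Sum>i\<in>UNIV. x i * apolar (y i) f) = of_nat d * f" if "f \<in> homog d" for f d
  proof -
    have "(\<Sum>i\<in>UNIV. x i * apolar (y i) f) = (\<Sum>n\<in>UNIV. (\<Sum>i\<in>UNIV. const (M n i) * x i) * apolar (indet n) f)"
      unfolding y_def
      by (simp add: sum_distrib_left sum_distrib_right apolar_sum_left apolar_mult
          sum.swap[of _ "UNIV :: 'i set"] del: One_nat_def) (simp only: mult_ac)
    then show ?thesis unfolding M[symmetric] using euler[OF that] by simp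
  qed
  ultimately show ?thesis using y dual by (intro exI[of _ y]) simp
qed

text \<open>For a linear form killed by \<open>b\<close> and \<open>c\<close>, Euler's identity
  leaves a multiple of \<open>ya\<close>. This identifies the points v_j with those of the dual
  basis.\<close>

lemma perp_1_pair:
  assumes fr: "apolar_frame a b c ya yb yc"
  shows "perp 1 (sym.span {b, c}) = sym.span {ya}"
proof -
  interpret apolar_frame a b c ya yb yc by (rule fr)
  have p1: "apolar z p \<in> homog 0" if "z \<in> homog 1" "p \<in> homog 1" for z p :: "('a, 'b) sym"
    using homog_apolar[of z 1 p 0] that by simp
  show ?thesis
  proof (intro equalityI subsetI)
    fix p assume p: "p \<in> perp 1 (sym.span {b, c})"
    then have h: "p \<in> homog 1" by (simp add: perp_def)
    have "pairing b p = 0" "pairing c p = 0"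
      using p sym.span_base[of _ "{b, c}"] by (auto simp: perp_def)
    then have "apolar b p = 0" "apolar c p = 0"
      using homog_0_eq_const[OF p1[OF deg(2) h]] homog_0_eq_const[OF p1[OF deg(3) h]]
      by (simp_all add: pairing_def)
    moreover obtain s where "apolar a p = const s" using p1[OF deg(1) h] by (rule homog_0E)
    ultimately have "p = const s * ya"
      using euler_lower[OF h] by (simp add: mult.commute)
    then show "p \<in> sym.span {ya}" by (auto simp: span_singleton_const)
  next
    fix p assume "p \<in> sym.span {ya}"
    then obtain s where s: "p = const s * ya" by (auto simp: span_singleton_const)
    have "pairing z p = 0" if z: "z \<in> sym.span {b, c}" for z
    proof -
      obtain k l where "z - scale k b = scale l c"
        using z by (auto simp: sym.span_breakdown_eq sym.span_singleton)
      then have "z = const l * c + const k * b" by (simp add: scale_def diff_eq_eq)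
      then show ?thesis
        by (simp add: pairing_def s apolar_add_left apolar_mult apolar_const_mult_right)
    qed
    then show "p \<in> perp 1 (sym.span {b, c})"
      using deg by (auto simp: perp_def s homog_const_mult)
  qed
qed

section \<open>The decomposition\<close>

text \<open>A single dual basis serves all three cyclic rotations, so frames of neighbouring indices
  share their vectors.\<close>

lemma frames_exist:
  fixes x :: "3 \<Rightarrow> ('n::finite, 'k::{alg_closed_field, field_char_0}) sym"
  assumes dim: "CARD('n) = 3" and x: "\<And>i. x i \<in> homog 1"
    and ind: "inj x" "sym.independent (range x)"
  shows "\<exists>y. \<forall>i. closed_apolar_frame (x i) (x (i + 1)) (x (i + 2)) (y i) (y (i + 1)) (y (i + 2))"
proof -
  have "CARD('n) = CARD(3)" using dim by simp
  then obtain y where y: "\<And>i. y i \<in> homog 1" "\<And>i j. apolar (x i) (y j) = (if i = j then 1 else 0)"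
      "\<And>f d. f \<in> homog d \<Longrightarrow> (\<Sum>i\<in>UNIV. y i * apolar (x i) f) = of_nat d * f"
      "\<And>f d. f \<in> homog d \<Longrightarrow> (\<Sum>i\<in>UNIV. x i * apolar (y i) f) = of_nat d * f"
    using dual_basis[of x] x ind by blast
  have "y i * apolar (x i) f + y (i + 1) * apolar (x (i + 1)) f + y (i + 2) * apolar (x (i + 2)) f = of_nat d * f"
      "x i * apolar (y i) f + x (i + 1) * apolar (y (i + 1)) f + x (i + 2) * apolar (y (i + 2)) f = of_nat d * f"
    if "f \<in> homog d" for f d i
    using y(3,4)[OF that] unfolding sum_three[of _ i] by (simp_all only: add.assoc)
  then have "closed_apolar_frame (x i) (x (i + 1)) (x (i + 2)) (y i) (y (i + 1)) (y (i + 2))" for i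
    by unfold_locales (simp_all add: x y(1,2) del: One_nat_def)
  then show ?thesis by blast
qed

lemma qproj_qperp_member:
  assumes q: "q \<in> kercomp a d" and P: "P \<in> qproj a (qperp a d q)" and X: "X \<in> P"
  shows "\<exists>p. X = qclass a p"
proof -
  obtain h where "P = qline a h"
    using P unfolding qproj_qperp[OF q] by blast
  with X obtain s where "X = qclass a (const s * h)"
    unfolding qline_def by blast
  then show ?thesis by (rule exI)
qed

text \<open>Numbers the chosen vectors consecutively. Disjointness turns the choice that depends on
  the index \<open>i\<close> into one function \<open>M\<close> on the union.\<close>

lemma sum_disjoint_powers:
  fixes l :: "'i::finite \<Rightarrow> ('n, 'k::field) sym set \<Rightarrow> ('n, 'k) sym"
  assumes R: "\<And>i. card (R i) = 2" "\<And>i j. i \<noteq> j \<Longrightarrow> R i \<inter> R j = {}"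
    and l: "\<And>i r. r \<in> R i \<Longrightarrow> Q (l i r) \<and> sym.span {l i r} = r"
  shows "\<exists>L :: nat \<Rightarrow> ('n, 'k) sym. (\<forall>j\<in>{1..2 * CARD('i)}. Q (L j))
    \<and> bij_betw (\<lambda>j. sym.span {L j}) {1..2 * CARD('i)} (\<Union>i. R i)
    \<and> (\<Sum>i\<in>UNIV. \<Sum>r\<in>R i. l i r ^ k) = (\<Sum>j = 1..2 * CARD('i). L j ^ k)"
proof -
  have fin: "finite (R i)" for i using R(1)[of i] by (metis card.infinite zero_neq_numeral)
  have "card (\<Union>i. R i) = (\<Sum>i\<in>UNIV. card (R i))"
    by (rule card_UN_disjoint) (use fin R(2) in auto)
  then have "card (\<Union>i. R i) = 2 * CARD('i)" by (simp add: R(1))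
  then obtain e where e: "bij_betw e {1..2 * CARD('i)} (\<Union>i. R i)"
    using ex_bij_betw_nat_finite_1[of "\<Union>i. R i"] fin by auto
  define M where "M r = l (SOME i. r \<in> R i) r" for r
  have M: "M r = l i r" if "r \<in> R i" for i r
  proof -
    have "(SOME i. r \<in> R i) = i"
      using that R(2) by (intro some_equality) blast+
    then show ?thesis by (simp add: M_def)
  qed
  have M': "Q (M r) \<and> sym.span {M r} = r" if "r \<in> (\<Union>i. R i)" for r
    using that l M by force
  have er: "e j \<in> (\<Union>i. R i)" if "j \<in> {1..2 * CARD('i)}" for j
    using that e by (meson bij_betwE)
  have "(\<Sum>i\<in>UNIV. \<Sum>r\<in>R i. l i r ^ k) = (\<Sum>i\<in>UNIV. \<Sum>r\<in>R i. M r ^ k)"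
    by (intro sum.cong refl) (simp add: M)
  also have "\<dots> = (\<Sum>r\<in>(\<Union>i. R i). M r ^ k)"
    by (rule sum.UNION_disjoint[symmetric]) (use fin R(2) in auto)
  also have "\<dots> = (\<Sum>j = 1..2 * CARD('i). M (e j) ^ k)"
    by (rule sum.reindex_bij_betw[OF e, symmetric])
  finally have "(\<Sum>i\<in>UNIV. \<Sum>r\<in>R i. l i r ^ k) = (\<Sum>j = 1..2 * CARD('i). M (e j) ^ k)" .
  moreover have "bij_betw (\<lambda>j. sym.span {M (e j)}) {1..2 * CARD('i)} (\<Union>i. R i)"
    using e er M' by (subst bij_betw_cong[of _ _ e]) auto
  ultimately show ?thesis
    using er M' by (intro exI[of _ "\<lambda>j. M (e j)"]) simp
qed

theorem proposition3p3:
  fixes f :: "('n::finite, 'k::{alg_closed_field, field_char_0}) sym"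
    and x q v :: "3 \<Rightarrow> ('n, 'k) sym"
    and \<theta> :: "3 \<Rightarrow> ('n, 'k) sym set set \<Rightarrow> ('n, 'k) sym set set"
    and H :: "3 \<Rightarrow> ('n, 'k) sym set set"
  assumes dim: "CARD('n) = 3"
    and f: "f \<in> homog 4"
    and x: "\<And>i. x i \<in> homog 1"
    and x_indep: "inj x" "sym.independent (range x)"
    and x_f: "apolar (x 0 * x 1 * x 2) f = 0"
    and q: "\<And>i. q i = apolar (x (i + 1) * x (i + 2)) f"
    and v: "\<And>i. sym.span {v i} = perp 1 (sym.span {x (i + 1), x (i + 2)})"
    and q_not_square: "\<And>i. \<not> (\<exists>l\<in>homog 1. q i = l ^ 2)"
    and \<theta>: "\<And>i. \<theta> i = theta (apolar (x (i + 2)) f) (x i) (x (i + 1))"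
    and H0: "H 0 \<in> qproj (x 0) (qperp (x 0) 2 (q 0))"
    and H0_fixed: "(\<theta> 2 \<circ> \<theta> 1 \<circ> \<theta> 0) (H 0) = H 0"
    and H1: "H 1 = \<theta> 0 (H 0)"
    and H2: "H 2 = \<theta> 1 (H 1)"
    and two_roots: "\<And>i. card (qroots (x i) (H i)) = 2"
    and roots_distinct: "\<And>i j. i \<noteq> j \<Longrightarrow> qroots (x i) (H i) \<inter> qroots (x j) (H j) = {}"
    and roots_not_v: "\<And>i j. sym.span {v j} \<notin> qroots (x i) (H i)"
  shows "\<exists>l :: nat \<Rightarrow> ('n, 'k) sym.
           (\<forall>j\<in>{1..6}. l j \<in> homog 1 \<and> l j \<noteq> 0)
         \<and> bij_betw (\<lambda>j. sym.span {l j}) {1..6} (\<Union>i. qroots (x i) (H i))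
         \<and> f = (\<Sum>j = 1..6. l j ^ 4)"
proof -
  obtain y where frames: "\<And>i. closed_apolar_frame (x i) (x (i + 1)) (x (i + 2)) (y i) (y (i + 1)) (y (i + 2))"
    using frames_exist[OF dim x x_indep] by blast
  note frame = closed_apolar_frame.axioms[OF frames]
  have y: "sym.span {y j} \<notin> qroots (x i) (H i)" for i j
    using roots_not_v[of j i] unfolding v perp_1_pair[OF frame] .
  have g3: "apolar (x k) f \<in> homog 3" for k
    using homog_apolar[of "x k" 1 f 3] x f by simp
  have x_f': "apolar (x i) (apolar (x (i + 1)) (apolar (x (i + 2)) f)) = 0" for i
  proof -
    \<comment> \<open>The product over all indices does not depend on where the cycle
      starts.\<close>
    have "x i * (x (i + 1) * x (i + 2)) = x 0 * (x (0 + 1) * x (0 + 2))"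
      by (simp only: prod_three[of x, symmetric])
    then have "apolar (x i * (x (i + 1) * x (i + 2))) f = 0"
      using x_f by (simp only: mult.assoc add_0)
    then show ?thesis by (simp only: apolar_mult)
  qed
  have qb: "apolar (x (i + 1)) (apolar (x (i + 2)) f) = q i" for i
    by (simp add: q apolar_mult)
  have qa: "apolar (x i) (apolar (x (i + 2)) f) = q (i + 1)" for i
    using qb[of "i + 1"] by (simp add: three_cycle apolar_commute)
  have qk: "q i \<in> kercomp (x i) 2" for i
    using homog_apolar[of "x (i + 1)" 1 "apolar (x (i + 2)) f" 2] x g3 x_f'[of i]
    by (simp add: kercomp_def qb[symmetric] numeral_2_eq_2 numeral_3_eq_3)
  note theta_props = closed_apolar_frame.theta_props[OF frames, OF g3]
  have step: "\<theta> i (H i) \<in> qproj (x (i + 1)) (qperp (x (i + 1)) 2 (q (i + 1))) \<and>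
    (\<exists>F l. F \<in> kercomp (x i) 3 \<and> F \<noteq> 0 \<and> apolar (x (i + 1)) F = const l * q i
      \<and> (\<forall>X\<in>H i. qapolar X F = 0) \<and> (\<forall>X\<in>\<theta> i (H i). qapolar X (const l * apolar (x (i + 2)) f - F) = 0))"
    if "H i \<in> qproj (x i) (qperp (x i) 2 (q i))" for i
  proof -
    have "apolar (x i * x (i + 1)) (apolar (x (i + 2)) f) = 0"
      using x_f' by (simp only: apolar_mult)
    then show ?thesis
      unfolding \<theta>
      by (rule theta_props[of i "i + 2" "H i", unfolded qa qb, OF _ q_not_square q_not_square that])
  qed
  have H_next: "H (i + 1) = \<theta> i (H i)" for i
  proof -
    have "i \<in> {0, 0 + 1, 0 + 2}" using UNIV_three[of 0] by blast
    \<comment> \<open>In the integers modulo 3 the numeral \<open>3\<close> is \<open>0\<close>, so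
      the fixed point closes the cycle.\<close>
    moreover have "H 3 = H 0" by (rule arg_cong[of 3 0 H]) simp
    ultimately show ?thesis using H0_fixed H1 H2 by (elim insertE) (simp_all add: comp_def)
  qed
  have H: "H i \<in> qproj (x i) (qperp (x i) 2 (q i))" for i
  proof -
    have 1: "H 1 \<in> qproj (x 1) (qperp (x 1) 2 (q 1))"
      using step[OF H0] H_next[of 0] by simp
    have 2: "H 2 \<in> qproj (x 2) (qperp (x 2) 2 (q 2))"
      using step[OF 1] H_next[of 1] by simp
    have "i \<in> {0, 0 + 1, 0 + 2}" using UNIV_three[of 0] by blast
    then show ?thesis using H0 1 2 by auto
  qed
  define Q where "Q i l g \<longleftrightarrow> (\<forall>R\<in>qroots (x i) (H i). l R \<in> homog 1 \<and> l R \<noteq> 0 \<and> sym.span {l R} = R)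
    \<and> g = (\<Sum>R\<in>qroots (x i) (H i). l R ^ 4) \<and> g \<in> kercomp (x i) 4
    \<and> apolar (x (i + 1)) (apolar (x (i + 2)) g) = q i
    \<and> (\<forall>z. \<forall>X\<in>H i. qapolar X (apolar z g) = 0)" for i l g
  have "\<exists>l g. Q i l g" for i
    unfolding Q_def by (rule closed_apolar_frame.qroots_quartic[OF frames qk q_not_square H two_roots y y])
  then obtain l g where Q: "Q i (l i) (g i)" for i by metis
  have lR: "(l i R \<in> homog 1 \<and> l i R \<noteq> 0) \<and> sym.span {l i R} = R" if "R \<in> qroots (x i) (H i)" for i R
    using Q[of i] that unfolding Q_def by blast
  have g: "g i = (\<Sum>R\<in>qroots (x i) (H i). l i R ^ 4)" for i
    using Q[of i] unfolding Q_def by blast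
  have gk: "g i \<in> kercomp (x i) 4" for i
    using Q[of i] unfolding Q_def by blast
  have bc: "apolar (x (i + 1)) (apolar (x (i + 2)) (g i)) = q i" for i
    using Q[of i] unfolding Q_def by blast
  have kill: "qapolar X (apolar z (g i)) = 0" if "X \<in> H i" for i z X
    using Q[of i] that unfolding Q_def by blast
  have g4: "apolar (x k) (g i) \<in> kercomp (x i) 3" for i k
    using kercomp_apolar[of "x k" "g i" "x i" 3] x gk by simp
  have qapolar_diff: "qapolar X (F - G) = 0"
    if X: "X \<in> H i" "F \<in> kercomp (x i) d" "G \<in> kercomp (x i) d" "qapolar X F = 0" "qapolar X G = 0" for X F G i d
  proof -
    obtain p where "X = qclass (x i) p"
      using qproj_qperp_member[OF qk H X(1)] by blast
    then show ?thesis
      using X(2-5) by (simp add: kercomp_def qapolar_qclass apolar_diff_right)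
  qed
  have qapolar_mult: "qapolar X (const s * F) = 0"
    if X: "X \<in> H i" "F \<in> kercomp (x i) d" "qapolar X F = 0" for X F i d s
  proof -
    obtain p where "X = qclass (x i) p"
      using qproj_qperp_member[OF qk H X(1)] by blast
    then show ?thesis
      using X(2-3) by (simp add: kercomp_def qapolar_qclass apolar_const_mult_right)
  qed
  \<comment> \<open>The cubics \<open>F\<close> and \<open>?G\<close> below add up to
    \<open>const l\<close> times the derivative of \<open>f\<close>; each is identified with the
    derivative of one of the quartics.\<close>
  have key: "apolar (x (i + 2)) (f - (\<Sum>k\<in>UNIV. g k)) = 0" for i
  proof -
    obtain F l where F: "F \<in> kercomp (x i) 3" "F \<noteq> 0" "apolar (x (i + 1)) F = const l * q i"
        "\<And>X. X \<in> H i \<Longrightarrow> qapolar X F = 0"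
        "\<And>X. X \<in> H (i + 1) \<Longrightarrow> qapolar X (const l * apolar (x (i + 2)) f - F) = 0"
      using step[OF H[of i]] unfolding H_next[symmetric] by blast
    let ?G = "const l * apolar (x (i + 2)) f - F"
    \<comment> \<open>Both terms have derivative \<open>const l * q i\<close> along
      \<open>x (i + 1)\<close> and are annihilated by \<open>H i\<close>.\<close>
    have "F - const l * apolar (x (i + 2)) (g i) = 0"
    proof (rule apolar_frame.eq_0_if_killed[OF frame _ _ H qk _ y])
      show "F - const l * apolar (x (i + 2)) (g i) \<in> kercomp (x i) 3"
        by (intro kercomp_diff kercomp_const_mult F(1) g4)
      show "apolar (x (i + 1)) (F - const l * apolar (x (i + 2)) (g i)) = 0"
        by (simp add: apolar_diff_right apolar_const_mult_right F(3) bc)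
      show "\<forall>X\<in>H i. qapolar X (F - const l * apolar (x (i + 2)) (g i)) = 0"
        by (intro ballI qapolar_diff[OF _ F(1) kercomp_const_mult[OF g4] F(4) qapolar_mult[OF _ g4 kill]])
    qed
    then have F_eq: "F = const l * apolar (x (i + 2)) (g i)" by simp
    have xF: "apolar (x i) F = 0" using F(1) by (simp add: kercomp_def)
    have Gk: "?G \<in> kercomp (x (i + 1)) 3"
      using F g3 by (simp add: kercomp_def homog_diff homog_const_mult apolar_diff_right
          apolar_const_mult_right qb)
    \<comment> \<open>The same comparison in the swapped frame: both terms have derivative
      \<open>const l * q (i + 1)\<close> along \<open>x i\<close> and are annihilated by
      \<open>H (i + 1)\<close>.\<close>
    have "?G - const l * apolar (x (i + 2)) (g (i + 1)) = 0"
    proof (rule apolar_frame.eq_0_if_killed[OF apolar_frame.swap_ab[OF frame] _ _ H qk _ y])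
      show "?G - const l * apolar (x (i + 2)) (g (i + 1)) \<in> kercomp (x (i + 1)) 3"
        by (intro kercomp_diff[OF Gk] kercomp_const_mult g4)
      have "apolar (x i) (apolar (x (i + 2)) (g (i + 1))) = q (i + 1)"
        using bc[of "i + 1"] by (simp add: three_cycle apolar_commute)
      then show "apolar (x i) (?G - const l * apolar (x (i + 2)) (g (i + 1))) = 0"
        by (simp add: apolar_diff_right apolar_const_mult_right xF qa)
      show "\<forall>X\<in>H (i + 1). qapolar X (?G - const l * apolar (x (i + 2)) (g (i + 1))) = 0"
        by (intro ballI qapolar_diff[OF _ Gk kercomp_const_mult[OF g4] F(5) qapolar_mult[OF _ g4 kill]])
    qed
    then have "const l * apolar (x (i + 2)) (f - g i - g (i + 1)) = 0"
      by (simp add: apolar_diff_right F_eq right_diff_distrib)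
    moreover have "l \<noteq> 0" using F(2) F_eq by auto
    ultimately have "apolar (x (i + 2)) (f - g i - g (i + 1)) = 0"
      using const_mult_eq_0 by blast
    moreover have "apolar (x (i + 2)) (g (i + 2)) = 0"
      using gk by (simp add: kercomp_def)
    ultimately show ?thesis
      unfolding sum_three[of g i] by (simp add: apolar_diff_right apolar_add_right algebra_simps)
  qed
  let ?D = "f - (\<Sum>k\<in>UNIV. g k)"
  have "?D \<in> homog 4"
    using gk by (intro homog_diff f homog_sum) (simp add: kercomp_def)
  then have "of_nat (Suc 3) * ?D = y 0 * apolar (x 0) ?D + y (0 + 1) * apolar (x (0 + 1)) ?D
      + y (0 + 2) * apolar (x (0 + 2)) ?D"
    using apolar_frame.euler_lower[OF frame[of 0], of ?D 4] by simp
  \<comment> \<open>\<open>key\<close> at index \<open>k + 1\<close> concerns \<open>x k\<close>, so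
    all three derivatives vanish.\<close>
  also have "\<dots> = 0"
    using key[of "k + 1" for k, unfolded three_cycle] by simp
  finally have "?D = 0"
    using apolar_frame.of_nat_mult_eq[OF frame[of 0], of 3 ?D 0] by simp
  then have "f = (\<Sum>i\<in>UNIV. \<Sum>R\<in>qroots (x i) (H i). l i R ^ 4)"
    by (simp add: g)
  then show ?thesis
    using sum_disjoint_powers[where R = "\<lambda>i. qroots (x i) (H i)" and l = l and k = 4 and
        Q = "\<lambda>l. l \<in> homog 1 \<and> l \<noteq> 0", OF two_roots roots_distinct lR] by simp
qed

end
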